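(* Let $\mathcal{H}$ be a real Hilbert space, let $m\geq 1$ be an integer, and let $f_1,\ldots,f_m$ be functions in $\Gamma_0(\mathcal{H})$. Let $G$ be the set of solutions to the problem of minimizing $\sum_{i=1}^m f_i(x)$ over $x\in\mathcal{H}$. Let $\gamma\in\,]0,+\infty[$, let $(\omega_i)_{1\leq i\leq m}\in\,]0,1]^m$ satisfy $\sum_{i=1}^m\omega_i=1$, let $(y_{i,0})_{1\leq i\leq m}\in\mathcal{H}^m$, let $(\lambda_n)_{n\in\mathbb{N}}$ be a sequence in $]0,2[$, and, for every $i\in\{1,\ldots,m\}$, let $(a_{i,n})_{n\in\mathbb{N}}$ be a sequence in $\mathcal{H}$. Set $x_0=\sum_{i=1}^m\omega_i y_{i,0}$ and, for every $n\in\mathbb{N}$, $$p_{i,n}=\operatorname{prox}_{\gamma f_i/\omega_i}y_{i,n}+a_{i,n}\quad(1\leq i\leq m),\qquad p_n=\sum_{i=1}^m\omega_i p_{i,n},$$ $$y_{i,n+1}=y_{i,n}+\lambda_n(2p_n-x_n-p_{i,n})\quad(1\leq i\leq m),\qquad x_{n+1}=x_n+\lambda_n(p_n-x_n).$$ Suppose that the following hold: (i) $\lim_{\|x\|\to+\infty}f_1(x)+\cdots+f_m(x)=+\infty$; (ii) $(0,\ldots,0)\in\operatorname{sri}\{(x-x_1,\ldots,x-x_m)\mid x\in\mathcal{H},\,x_1\in\operatorname{dom}f_1,\ldots,x_m\in\operatorname{dom}f_m\}$; (iii) $\sum_{n\in\mathbb{N}}\lambda_n(2-\lambda_n)=+\infty$;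 (iv) for every $i\in\{1,\ldots,m\}$, $\sum_{n\in\mathbb{N}}\lambda_n\|a_{i,n}\|<+\infty$. Then $G\neq\varnothing$ and $(x_n)_{n\in\mathbb{N}}$ converges weakly to a point in $G$.
   Context: $\Gamma_0(\mathcal{H})$ is the class of lower semicontinuous convex functions from $\mathcal{H}$ to $]-\infty,+\infty]$ that are proper (nonempty domain), where $\operatorname{dom}f=\{x\in\mathcal{H}\mid f(x)<+\infty\}$. For $f\in\Gamma_0(\mathcal{H})$, the proximity operator $\operatorname{prox}_f\colon\mathcal{H}\to\mathcal{H}$ maps $x$ to the unique minimizer over $y\in\mathcal{H}$ of $f(y)+\frac12\|x-y\|^2$. For a nonempty convex subset $C$ of a real Hilbert space, $\operatorname{cone}C=\bigcup_{\lambda>0}\{\lambda x\mid x\in C\}$, $\overline{\operatorname{span}}\,C$ is the closure of the linear span of $C$, and the strong relative interior of $C$ is $\operatorname{sri}C=\{x\in C\mid\operatorname{cone}(C-x)=\overline{\operatorname{span}}(C-x)\}$. In (ii), the strong relative interior is taken in $\mathcal{H}^m$ with its product (Hilbert space) topology. *)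

theory Defs
  imports "HOL-Analysis.Analysis"
begin

(* A real Hilbert space is a type of sort {real_inner, complete_space}, and the product Hilbert
   space H^m is 'a ^ 'm with CARD('m) = m; its norm is the l2 norm of the components.
   A function into ]-oo,+oo] is an ereal-valued function that avoids -oo. *)

definition edom :: "('a \<Rightarrow> ereal) \<Rightarrow> 'a set" where
  "edom f = {x. f x < \<infinity>}"

definition lsc :: "('a::topological_space \<Rightarrow> ereal) \<Rightarrow> bool" where
  "lsc f \<longleftrightarrow> (\<forall>x. f x \<le> Liminf (nhds x) f)"

(* convex_on is restricted to real-valued functions. The coefficients are strictly between 0 and 1,
   and econvex is only used together with f > -oo, so the right-hand side is never oo - oo. *)
definition econvex :: "('a::real_vector \<Rightarrow> ereal) \<Rightarrow> bool" where
  "econvex f \<longleftrightarrow> (\<forall>x y. \<forall>t\<in>{0<..<1::real}.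
      f (t *\<^sub>R x + (1 - t) *\<^sub>R y) \<le> ereal t * f x + ereal (1 - t) * f y)"

definition Gamma0 :: "('a::real_normed_vector \<Rightarrow> ereal) set" where
  "Gamma0 = {f. (\<forall>x. f x \<noteq> -\<infinity>) \<and> edom f \<noteq> {} \<and> lsc f \<and> econvex f}"

definition minimizers :: "('a \<Rightarrow> ereal) \<Rightarrow> 'a set" where
  "minimizers f = {x. is_arg_min f (\<lambda>_. True) x}"

(* Only meaningful when the minimizer exists and is unique, as it does for f in Gamma0 on a
   Hilbert space. *)
definition prox :: "('a::real_normed_vector \<Rightarrow> ereal) \<Rightarrow> 'a \<Rightarrow> 'a" where
  "prox f x = (THE p. p \<in> minimizers (\<lambda>y. f y + ereal (1/2 * (norm (x - y))\<^sup>2)))"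

(* Scalars are strictly positive: unlike for the library's conic hulls, 0 is not added. *)
definition cone_of :: "'a::real_vector set \<Rightarrow> 'a set" where
  "cone_of C = (\<Union>c\<in>{0<..}. {c *\<^sub>R x | x. x \<in> C})"

definition sri :: "'a::real_normed_vector set \<Rightarrow> 'a set" where
  "sri C = {x\<in>C. cone_of ((\<lambda>z. z - x) ` C) = closure (span ((\<lambda>z. z - x) ` C))}"

definition converges_weakly_to :: "(nat \<Rightarrow> 'a::real_inner) \<Rightarrow> 'a \<Rightarrow> bool" where
  "converges_weakly_to x z \<longleftrightarrow> (\<forall>u. (\<lambda>n. x n \<bullet> u) \<longlonglongrightarrow> z \<bullet> u)"

end

theory Submission
  imports Defs
begin

text \<open>
  The recursion is the Douglas-Rachford iteration in the product space. Give \<open>H\<^sup>m\<close> the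
  inner product weighted by \<open>\<omega>\<close>, let \<open>D\<close> be its diagonal, whose projector \<open>P\<close> replaces every
  component by the \<open>\<omega>\<close>-mean, and let \<open>J\<close> act on the \<open>i\<close>-th component as the proximity operator of
  \<open>\<gamma> f\<^sub>i / \<omega>\<^sub>i\<close>. Up to the summable error coming from \<open>a\<close>, the step is
  \<open>y + (\<lambda>/2) (R y - y)\<close>, where \<open>R = (2 P - Id) (2 J - Id)\<close> composes a linear isometry with a
  nonexpansive map, and \<open>x\<^sub>n\<close> is the mean of the \<open>y\<^sub>i\<^sub>,\<^sub>n\<close>. A fixed point \<open>y\<close> of \<open>R\<close> satisfies
  \<open>J y = P y\<close>; then the vectors \<open>(\<omega>\<^sub>i / \<gamma>) (y\<^sub>i - x)\<close>, with \<open>x\<close> the mean of \<open>y\<close>, are subgradients of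
  the \<open>f\<^sub>i\<close> at \<open>x\<close> and sum to zero, so \<open>x\<close> minimizes the sum. Conversely, a family of subgradients
  \<open>u\<^sub>i\<close> at a minimizer \<open>x\<close> with sum zero yields the fixed point \<open>y\<^sub>i = x + (\<gamma> / \<omega>\<^sub>i) u\<^sub>i\<close>. The mean
  is weakly continuous, so it suffices that the iterates converge weakly to a fixed point of \<open>R\<close>.

  Three results carry the proof. Weak convergence of the iteration is \<open>krasnoselskii_mann\<close>: the
  distance to each fixed point converges, the residual \<open>R y - y\<close> tends to zero, weak cluster points
  are fixed points by demiclosedness, and Opial's argument leaves only one cluster point. Existence
  of a minimizer is \<open>Gamma0_coercive_minimizer_exists\<close>, by weak compactness. The existence of a
  fixed point rests on \<open>sum_subgradients_at_minimizer\<close>, the sum rule of Attouch and Brezis at a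
  minimizer, which is where the strong relative interior is needed: by Baire's theorem, the optimal
  value \<open>inf\<^sub>x \<Sum>\<^sub>i f\<^sub>i (x - v\<^sub>i)\<close> is bounded above for small \<open>v\<close> in the closed subspace generated
  by its domain, hence by convexity it decreases at most linearly from its value at 0, and a separation
  argument produces a subgradient at 0.

  The Hilbert space background comes out of proximity operators: projections are those of
  indicator functions, and the Riesz representation of a functional is read off from the one of its
  opposite. Weak cluster points are taken along filters, which avoids extracting subsequences in a
  space that need not be separable.
\<close>

section \<open>Proper lower semicontinuous convex functions\<close>

lemma Gamma0_not_minfty: "f \<in> Gamma0 \<Longrightarrow> f x \<noteq> -\<infinity>"
  by (auto simp: Gamma0_def)

lemma Gamma0_proper:
  assumes "f \<in> Gamma0"
  obtains x v where "f x = ereal v"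
proof -
  obtain x where "f x < \<infinity>"
    using assms by (auto simp: Gamma0_def edom_def)
  then show thesis
    using that[of x] Gamma0_not_minfty[OF assms, of x] by (cases "f x") auto
qed

lemma Gamma0_convexD:
  assumes "f \<in> Gamma0" "f x \<le> ereal a" "f y \<le> ereal b" "0 \<le> t" "t \<le> 1"
  shows "f (t *\<^sub>R x + (1 - t) *\<^sub>R y) \<le> ereal (t * a + (1 - t) * b)"
proof (cases "t = 0 \<or> t = 1")
  case True
  then show ?thesis using assms by auto
next
  case False
  then have t: "t \<in> {0<..<1}" using assms by auto
  obtain a' where a': "f x = ereal a'" "a' \<le> a"
    using assms Gamma0_not_minfty[OF assms(1), of x] by (cases "f x") auto
  obtain b' where b': "f y = ereal b'" "b' \<le> b"
    using assms Gamma0_not_minfty[OF assms(1), of y] by (cases "f y") auto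
  have "f (t *\<^sub>R x + (1 - t) *\<^sub>R y) \<le> ereal t * f x + ereal (1 - t) * f y"
    using assms(1) t by (auto simp: Gamma0_def econvex_def)
  also have "\<dots> = ereal (t * a' + (1 - t) * b')" by (simp add: a' b')
  also have "\<dots> \<le> ereal (t * a + (1 - t) * b)"
    using a' b' t by (auto intro!: add_mono mult_left_mono)
  finally show ?thesis .
qed

lemma Gamma0_sublevel_convex:
  assumes "f \<in> Gamma0"
  shows "convex {x. f x \<le> ereal c}"
proof (rule convexI)
  fix x y and u v :: real
  assume *: "x \<in> {x. f x \<le> ereal c}" "y \<in> {x. f x \<le> ereal c}" "0 \<le> u" "0 \<le> v" "u + v = 1"
  then have v: "v = 1 - u" by simp
  have "u * c + (1 - u) * c = c" by (simp add: algebra_simps)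
  then show "u *\<^sub>R x + v *\<^sub>R y \<in> {x. f x \<le> ereal c}"
    using Gamma0_convexD[OF assms, of x c y c u] * by (simp add: v)
qed

lemma lsc_eventually: "lsc f \<Longrightarrow> c < f x \<Longrightarrow> eventually (\<lambda>z. c < f z) (nhds x)"
  unfolding lsc_def by (intro less_LiminfD) (auto intro: less_le_trans)

lemma Gamma0_eventually: "f \<in> Gamma0 \<Longrightarrow> c < f x \<Longrightarrow> eventually (\<lambda>z. c < f z) (nhds x)"
  by (auto simp: Gamma0_def intro: lsc_eventually)

lemma Gamma0_sublevel_closed:
  assumes "f \<in> Gamma0"
  shows "closed {x. f x \<le> c}"
proof -
  have "open {x. c < f x}"
    by (subst open_subopen)
       (use Gamma0_eventually[OF assms] in \<open>fastforce simp: eventually_nhds\<close>)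
  moreover have "- {x. c < f x} = {x. f x \<le> c}" by auto
  ultimately show ?thesis by (metis closed_def double_compl)
qed

text \<open>
  Sequential lower semicontinuity, in the form in which minimizing sequences use it.
\<close>

lemma Gamma0_tendsto_le:
  assumes f: "f \<in> Gamma0" and F: "F \<noteq> bot" and y: "(y \<longlongrightarrow> z) F"
    and le: "eventually (\<lambda>n. f (y n) \<le> ereal (s n)) F" and s: "(s \<longlongrightarrow> c) F"
  shows "f z \<le> ereal c"
proof (rule ccontr)
  assume "\<not> f z \<le> ereal c"
  then have "ereal c < f z" by simp
  then obtain d where d: "ereal c < ereal d" "ereal d < f z"
    using ereal_dense2 by blast
  have "eventually (\<lambda>n. ereal d < f (y n)) F"
    using Gamma0_eventually[OF f d(2)] y by (auto simp: filterlim_iff)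
  with le have "eventually (\<lambda>n. d \<le> s n) F"
  proof eventually_elim
    case (elim n)
    then have "ereal d < ereal (s n)" by (rule less_le_trans[rotated])
    then show ?case by simp
  qed
  then have "d \<le> c" using tendsto_lowerbound[OF s _ F] by blast
  with d show False by simp
qed

text \<open>
  Lower semicontinuity bounds \<open>f\<close> below near a point \<open>x\<close> of its domain. If \<open>f\<close> decreased faster
  than linearly along a ray from \<open>x\<close>, convexity would make it too small near \<open>x\<close>. The bound keeps
  the infimum of \<open>f\<close> finite on balls, and also that of \<open>f\<close> plus a quadratic term.
\<close>

lemma Gamma0_lower_bound:
  fixes f :: "'a::real_normed_vector \<Rightarrow> ereal"
  assumes f: "f \<in> Gamma0"
  obtains c d :: real where "d \<ge> 0" "\<And>y. ereal (c - d * norm y) \<le> f y"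
proof -
  obtain x v where x: "f x = ereal v" using Gamma0_proper[OF f] .
  have "ereal (v - 1) < f x" by (simp add: x)
  from Gamma0_eventually[OF f this] obtain r where r: "r > 0"
    "\<And>z. dist z x < r \<Longrightarrow> ereal (v - 1) < f z"
    by (auto simp: eventually_nhds_metric)
  define r' where "r' = r / 2"
  have r': "r' > 0" "r' < r" using r by (auto simp: r'_def)
  have b: "ereal (v - 1 - norm (y - x) / r') \<le> f y" for y
  proof (cases "dist y x < r")
    case True
    have "v - 1 - norm (y - x) / r' \<le> v - 1" using r' by simp
    then have "ereal (v - 1 - norm (y - x) / r') \<le> ereal (v - 1)" by simp
    also have "\<dots> \<le> f y" using r(2)[OF True] by simp
    finally show ?thesis .
  next
    case False
    then have n: "norm (y - x) \<ge> r" by (simp add: dist_norm)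
    show ?thesis
    proof (cases "f y")
      case (real b)
      \<comment> \<open>The point of the segment from \<open>x\<close> to \<open>y\<close> at distance \<open>r'\<close> from \<open>x\<close>, where \<open>f\<close> exceeds \<open>v - 1\<close>.\<close>
      define t where "t = r' / norm (y - x)"
      have t: "0 < t" "t < 1" using n r r' by (auto simp: t_def divide_simps)
      have "dist (t *\<^sub>R y + (1 - t) *\<^sub>R x) x = norm (t *\<^sub>R (y - x))"
        by (simp add: dist_norm algebra_simps)
      also have "\<dots> = r'" using n r r' by (auto simp: t_def)
      finally have "ereal (v - 1) < f (t *\<^sub>R y + (1 - t) *\<^sub>R x)" using r r' by simp
      also have "\<dots> \<le> ereal (t * b + (1 - t) * v)"
        using Gamma0_convexD[OF f, of y b x v t] t real x by simp
      finally have "t * (v - b) < 1" by (simp add: algebra_simps)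
      then have "v - b < 1 / t" using t by (simp add: field_simps)
      then show ?thesis by (simp add: t_def real)
    qed (use Gamma0_not_minfty[OF f, of y] in auto)
  qed
  show thesis
  proof (rule that[of "1 / r'" "v - 1 - norm x / r'"])
    fix y
    have "norm (y - x) / r' \<le> norm y / r' + norm x / r'"
      unfolding add_divide_distrib[symmetric]
      using r' by (intro divide_right_mono norm_triangle_ineq4) auto
    then have "ereal (v - 1 - norm x / r' - 1 / r' * norm y) \<le> ereal (v - 1 - norm (y - x) / r')"
      by simp
    with b[of y] show "ereal (v - 1 - norm x / r' - 1 / r' * norm y) \<le> f y"
      using order_trans by blast
  qed (use r' in auto)
qed

lemma Gamma0_scale:
  assumes f: "f \<in> Gamma0" and c: "c > 0"
  shows "(\<lambda>x. ereal c * f x) \<in> Gamma0"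
proof -
  have "ereal c * f x \<le> Liminf (nhds x) (\<lambda>x. ereal c * f x)" for x
    using f c by (subst Liminf_ereal_mult_left) (auto simp: Gamma0_def lsc_def intro!: ereal_mult_left_mono)
  moreover have "econvex (\<lambda>x. ereal c * f x)"
    unfolding econvex_def
  proof (intro allI ballI)
    fix x y and t :: real assume t: "t \<in> {0<..<1}"
    have "f (t *\<^sub>R x + (1 - t) *\<^sub>R y) \<le> ereal t * f x + ereal (1 - t) * f y"
      using f t by (auto simp: Gamma0_def econvex_def)
    then have "ereal c * f (t *\<^sub>R x + (1 - t) *\<^sub>R y) \<le> ereal c * (ereal t * f x + ereal (1 - t) * f y)"
      using c by (intro ereal_mult_left_mono) auto
    also have "\<dots> = ereal t * (ereal c * f x) + ereal (1 - t) * (ereal c * f y)"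
      using t c Gamma0_not_minfty[OF f, of x] Gamma0_not_minfty[OF f, of y]
      by (cases "f x"; cases "f y") (auto simp: algebra_simps)
    finally show "ereal c * f (t *\<^sub>R x + (1 - t) *\<^sub>R y)
      \<le> ereal t * (ereal c * f x) + ereal (1 - t) * (ereal c * f y)" .
  qed
  moreover have "ereal c * f x \<noteq> -\<infinity>" for x
    using c Gamma0_not_minfty[OF f, of x] by (cases "f x") auto
  moreover have "edom (\<lambda>x. ereal c * f x) \<noteq> {}"
  proof -
    obtain x v where "f x = ereal v" using Gamma0_proper[OF f] .
    then show ?thesis by (auto simp: edom_def intro!: exI[of _ x])
  qed
  ultimately show ?thesis by (simp add: Gamma0_def lsc_def)
qed

lemma sum_not_MInfty:
  fixes g :: "'i \<Rightarrow> ereal"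
  shows "(\<And>i. i \<in> A \<Longrightarrow> g i \<noteq> -\<infinity>) \<Longrightarrow> (\<Sum>i\<in>A. g i) \<noteq> -\<infinity>"
  by (induction A rule: infinite_finite_induct) auto

text \<open>
  A strict lower bound of a sum can be distributed over the summands. This reduces the lower
  semicontinuity of a sum, where infinite values occur, to that of its terms.
\<close>

lemma ereal_less_sum_split:
  fixes g :: "'i \<Rightarrow> ereal"
  assumes "finite A" "\<And>i. i \<in> A \<Longrightarrow> g i \<noteq> -\<infinity>" "ereal c < (\<Sum>i\<in>A. g i)"
  shows "\<exists>a. (\<forall>i\<in>A. ereal (a i) < g i) \<and> c < (\<Sum>i\<in>A. a i)"
  using assms
proof (induction A arbitrary: c rule: finite_induct)
  case empty
  then show ?case by (auto simp: zero_ereal_def)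
next
  case (insert j A)
  let ?S = "\<Sum>i\<in>A. g i"
  have "?S \<noteq> -\<infinity>" by (rule sum_not_MInfty) (use insert.prems(1) in auto)
  have lt: "ereal c < g j + ?S" using insert by simp
  have "\<exists>b d. ereal b < g j \<and> ereal d < ?S \<and> c < b + d"
  proof (cases "?S = \<infinity>")
    case True
    obtain b where "ereal b < g j"
      using ereal_dense2[of "-\<infinity>" "g j"] insert.prems(1)[of j] by auto
    then have "ereal b < g j \<and> ereal (c - b + 1) < ?S \<and> c < b + (c - b + 1)" using True by simp
    then show ?thesis by blast
  next
    case False
    then obtain S where S: "?S = ereal S" using \<open>?S \<noteq> -\<infinity>\<close> by (cases ?S) auto
    have "ereal (c - S) < g j" using lt S by (cases "g j") auto
    then obtain b where b: "ereal (c - S) < ereal b" "ereal b < g j" using ereal_dense2 by blast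
    then have "ereal b < g j \<and> ereal ((c - b + S) / 2) < ?S \<and> c < b + (c - b + S) / 2"
      using S by (simp add: field_simps)
    then show ?thesis by blast
  qed
  then obtain b d where bd: "ereal b < g j" "ereal d < ?S" "c < b + d" by blast
  obtain a where a: "\<forall>i\<in>A. ereal (a i) < g i" "d < (\<Sum>i\<in>A. a i)"
    using insert.IH[of d] insert.prems(1) bd(2) by auto
  have "(\<Sum>i\<in>A. (a(j := b)) i) = (\<Sum>i\<in>A. a i)" using insert.hyps by (intro sum.cong) auto
  then show ?case using a bd insert.hyps by (intro exI[of _ "a(j := b)"]) auto
qed

lemma Gamma0_sum:
  fixes f :: "'m::finite \<Rightarrow> 'a::real_normed_vector \<Rightarrow> ereal"
  assumes f: "\<And>i. f i \<in> Gamma0" and z: "\<And>i. z \<in> edom (f i)"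
  shows "(\<lambda>x. \<Sum>i\<in>UNIV. f i x) \<in> Gamma0"
proof -
  have ninf: "(\<Sum>i\<in>UNIV. f i x) \<noteq> -\<infinity>" for x
    by (intro sum_not_MInfty Gamma0_not_minfty[OF f])
  have "(\<Sum>i\<in>UNIV. f i z) \<noteq> \<infinity>" using z by (auto simp: sum_Pinfty edom_def)
  then have dom: "edom (\<lambda>x. \<Sum>i\<in>UNIV. f i x) \<noteq> {}" by (auto simp: edom_def intro!: exI[of _ z])
  have "(\<Sum>i\<in>UNIV. f i x) \<le> Liminf (nhds x) (\<lambda>x. \<Sum>i\<in>UNIV. f i x)" for x
    unfolding le_Liminf_iff
  proof (intro allI impI)
    fix c assume c: "c < (\<Sum>i\<in>UNIV. f i x)"
    then obtain c' where c': "c < ereal c'" "ereal c' < (\<Sum>i\<in>UNIV. f i x)" using ereal_dense2 by blast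
    then obtain a where a: "\<And>i. ereal (a i) < f i x" "c' < (\<Sum>i\<in>UNIV. a i)"
      using ereal_less_sum_split[of UNIV "\<lambda>i. f i x" c'] Gamma0_not_minfty[OF f] by auto
    have "eventually (\<lambda>y. \<forall>i. ereal (a i) < f i y) (nhds x)"
      by (intro eventually_all_finite Gamma0_eventually[OF f] a)
    then show "eventually (\<lambda>y. c < (\<Sum>i\<in>UNIV. f i y)) (nhds x)"
    proof eventually_elim
      case (elim y)
      have "(\<Sum>i\<in>UNIV. ereal (a i)) \<le> (\<Sum>i\<in>UNIV. f i y)" using elim by (intro sum_mono) (simp add: less_imp_le)
      moreover have "c < (\<Sum>i\<in>UNIV. ereal (a i))"
        using c'(1) a(2) by (auto intro: less_trans)
      ultimately show ?case by (rule less_le_trans[rotated])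
    qed
  qed
  moreover have "econvex (\<lambda>x. \<Sum>i\<in>UNIV. f i x)"
    unfolding econvex_def
  proof (intro allI ballI)
    fix x y and t :: real assume t: "t \<in> {0<..<1}"
    show "(\<Sum>i\<in>UNIV. f i (t *\<^sub>R x + (1 - t) *\<^sub>R y))
        \<le> ereal t * (\<Sum>i\<in>UNIV. f i x) + ereal (1 - t) * (\<Sum>i\<in>UNIV. f i y)"
    proof (cases "(\<Sum>i\<in>UNIV. f i x) = \<infinity> \<or> (\<Sum>i\<in>UNIV. f i y) = \<infinity>")
      case True
      then have *: "ereal t * (\<Sum>i\<in>UNIV. f i x) + ereal (1 - t) * (\<Sum>i\<in>UNIV. f i y) = \<infinity>"
        using t ninf[of x] ninf[of y]
        by (cases "\<Sum>i\<in>UNIV. f i x"; cases "\<Sum>i\<in>UNIV. f i y") auto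
      show ?thesis unfolding * by simp
    next
      case False
      then have fin: "f i x \<noteq> \<infinity>" "f i y \<noteq> \<infinity>" for i by (auto simp: sum_Pinfty)
      define a b where "a i = real_of_ereal (f i x)" and "b i = real_of_ereal (f i y)" for i
      have a: "f i x = ereal (a i)" for i
        using fin(1)[of i] Gamma0_not_minfty[OF f, of i x] by (cases "f i x") (auto simp: a_def)
      have b: "f i y = ereal (b i)" for i
        using fin(2)[of i] Gamma0_not_minfty[OF f, of i y] by (cases "f i y") (auto simp: b_def)
      have "(\<Sum>i\<in>UNIV. f i (t *\<^sub>R x + (1 - t) *\<^sub>R y)) \<le> (\<Sum>i\<in>UNIV. ereal (t * a i + (1 - t) * b i))"
        using t by (intro sum_mono Gamma0_convexD[OF f]) (auto simp: a b)
      then show ?thesis by (simp add: a b sum.distrib sum_distrib_left)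
    qed
  qed
  ultimately show ?thesis using ninf dom by (simp add: Gamma0_def lsc_def)
qed

section \<open>Subgradients and proximity operators\<close>

definition subgradient :: "('a::real_inner \<Rightarrow> ereal) \<Rightarrow> 'a \<Rightarrow> 'a \<Rightarrow> bool" where
  "subgradient f p u \<longleftrightarrow> (\<forall>y. f p + ereal (u \<bullet> (y - p)) \<le> f y)"

text \<open>
  The definition of a subgradient does not mention the domain; properness forces the base point
  into it.
\<close>

lemma subgradient_finite:
  assumes "f \<in> Gamma0" "subgradient f p u"
  obtains v where "f p = ereal v"
proof -
  obtain x w where "f x = ereal w" using Gamma0_proper[OF assms(1)] .
  with assms(2) have "f p + ereal (u \<bullet> (x - p)) \<le> ereal w" by (metis subgradient_def)
  then show thesis using that Gamma0_not_minfty[OF assms(1), of p] by (cases "f p") auto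
qed

lemma subgradient_monotone:
  assumes f: "f \<in> Gamma0" and "subgradient f p u" "subgradient f q v"
  shows "0 \<le> (u - v) \<bullet> (p - q)"
proof -
  obtain a where a: "f p = ereal a" using subgradient_finite[OF f assms(2)] .
  obtain b where b: "f q = ereal b" using subgradient_finite[OF f assms(3)] .
  have "a + u \<bullet> (q - p) \<le> b" "b + v \<bullet> (p - q) \<le> a"
    using assms(2)[unfolded subgradient_def, rule_format, of q]
      assms(3)[unfolded subgradient_def, rule_format, of p] by (simp_all add: a b)
  then show ?thesis by (simp add: inner_simps)
qed

lemma subgradient_scale:
  assumes f: "f \<in> Gamma0" and c: "c > 0"
  shows "subgradient (\<lambda>x. ereal c * f x) p (c *\<^sub>R u) \<longleftrightarrow> subgradient f p u"
proof -
  have "ereal c * f p + ereal (c *\<^sub>R u \<bullet> (y - p)) \<le> ereal c * f y \<longleftrightarrow> f p + ereal (u \<bullet> (y - p)) \<le> f y" for y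
  proof -
    have "c * a + c * (u \<bullet> (y - p)) \<le> c * b \<longleftrightarrow> a + u \<bullet> (y - p) \<le> b" for a b
      using c by (simp flip: distrib_left)
    then show ?thesis
      using c Gamma0_not_minfty[OF f, of p] Gamma0_not_minfty[OF f, of y]
      by (cases "f p"; cases "f y") auto
  qed
  then show ?thesis by (simp add: subgradient_def)
qed

text \<open>
  The elementary half of Fermat's rule for a sum: adding the subgradient inequalities cancels their
  linear parts.
\<close>

lemma subgradients_sum_zero_minimizer:
  fixes f :: "'m::finite \<Rightarrow> 'a::real_inner \<Rightarrow> ereal"
  assumes f: "\<And>i. f i \<in> Gamma0" and s: "\<And>i. subgradient (f i) p (u i)" and u: "(\<Sum>i\<in>UNIV. u i) = 0"
  shows "p \<in> minimizers (\<lambda>z. \<Sum>i\<in>UNIV. f i z)"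
proof -
  have "\<exists>v. f i p = ereal v" for i using subgradient_finite[OF f s] by metis
  then obtain h where h: "\<And>i. f i p = ereal (h i)" by metis
  have "(\<Sum>i\<in>UNIV. f i p) \<le> (\<Sum>i\<in>UNIV. f i y)" for y
  proof -
    have "(\<Sum>i\<in>UNIV. u i \<bullet> (y - p)) = 0" using u by (simp flip: inner_sum_left)
    then have "(\<Sum>i\<in>UNIV. f i p) = (\<Sum>i\<in>UNIV. f i p + ereal (u i \<bullet> (y - p)))"
      by (simp add: h sum.distrib)
    also have "\<dots> \<le> (\<Sum>i\<in>UNIV. f i y)" using s by (intro sum_mono) (simp add: subgradient_def)
    finally show ?thesis .
  qed
  then show ?thesis by (auto simp: minimizers_def is_arg_min_def not_less)
qed

text \<open>
  By strong convexity of the quadratic term, a minimizing sequence is Cauchy, and lower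
  semicontinuity puts its limit among the minimizers. The number \<open>m\<close> is the minimal value.
\<close>

lemma Gamma0_prox_exists:
  fixes f :: "'a::{real_inner, complete_space} \<Rightarrow> ereal"
  assumes f: "f \<in> Gamma0"
  obtains p and m :: real where "f p \<le> ereal (m - 1/2 * (norm (x - p))\<^sup>2)"
    "\<And>y. ereal (m - 1/2 * (norm (x - y))\<^sup>2) \<le> f y"
proof -
  define q where "q y = 1/2 * (norm (x - y))\<^sup>2" for y
  \<comment> \<open>The levels \<open>s\<close> reached by \<open>f + q\<close>; working with real levels keeps infinite values out of the infimum.\<close>
  define M where "M = {s. \<exists>y. f y \<le> ereal (s - q y)}"
  obtain c d where cd: "d \<ge> 0" "\<And>y. ereal (c - d * norm y) \<le> f y"
    using Gamma0_lower_bound[OF f] by metis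
  have low: "c - d * norm x - d\<^sup>2 / 2 \<le> s" if "s \<in> M" for s
  proof -
    obtain y where "f y \<le> ereal (s - q y)" using \<open>s \<in> M\<close> by (auto simp: M_def)
    with cd(2)[of y] have "ereal (c - d * norm y) \<le> ereal (s - q y)" by (rule order_trans)
    then have 1: "c - d * norm y \<le> s - q y" by simp
    have "norm y \<le> norm x + norm (x - y)" using norm_triangle_ineq4[of x "x - y"] by simp
    then have 2: "d * norm y \<le> d * norm x + d * norm (x - y)"
      using cd(1) mult_left_mono[of "norm y" "norm x + norm (x - y)" d]
      by (simp add: distrib_left)
    have "0 \<le> 1/2 * (norm (x - y) - d)\<^sup>2" by simp
    also have "\<dots> = q y - d * norm (x - y) + d\<^sup>2 / 2"
      by (simp add: q_def power2_eq_square field_simps)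
    finally show ?thesis using 1 2 by simp
  qed
  have bdd: "bdd_below M" using low by (auto simp: bdd_below_def)
  obtain x0 v0 where "f x0 = ereal v0" using Gamma0_proper[OF f] .
  then have "v0 + q x0 \<in> M" by (auto simp: M_def intro!: exI[of _ x0])
  then have ne: "M \<noteq> {}" by auto
  define m where "m = Inf M"
  have m_le: "m \<le> s" if "s \<in> M" for s unfolding m_def by (rule cInf_lower[OF that bdd])
  define e where "e n = 1 / real (Suc n)" for n
  have "\<exists>y. f y \<le> ereal (m + e n - q y)" for n
  proof -
    have "Inf M < m + e n" by (simp add: m_def e_def)
    then obtain s where s: "s \<in> M" "s < m + e n" using cInf_lessD[OF ne] by blast
    then obtain y where "f y \<le> ereal (s - q y)" by (auto simp: M_def)
    also have "\<dots> \<le> ereal (m + e n - q y)" using s by simp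
    finally show ?thesis by blast
  qed
  then obtain y where y: "\<And>n. f (y n) \<le> ereal (m + e n - q (y n))" by metis
  \<comment> \<open>The parallelogram identity: the midpoint gains \<open>1/8\<close> of the squared distance over the average level.\<close>
  have mid: "(norm (y n - y k))\<^sup>2 \<le> 4 * (e n + e k)" for n k
  proof -
    define z where "z = (1/2) *\<^sub>R y n + (1 - 1/2) *\<^sub>R y k"
    have "f z \<le> ereal (1/2 * (m + e n - q (y n)) + (1 - 1/2) * (m + e k - q (y k)))"
      unfolding z_def by (rule Gamma0_convexD[OF f y y]) auto
    then have "m \<le> 1/2 * (m + e n - q (y n)) + (1 - 1/2) * (m + e k - q (y k)) + q z"
      by (intro m_le) (auto simp: M_def intro!: exI[of _ z])
    moreover have "q z = 1/2 * q (y n) + 1/2 * q (y k) - 1/8 * (norm (y n - y k))\<^sup>2"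
      unfolding q_def z_def power2_norm_eq_inner
      by (simp add: inner_simps inner_commute algebra_simps)
    ultimately show ?thesis by (simp add: field_simps)
  qed
  have e0: "e \<longlonglongrightarrow> 0" unfolding e_def by (rule LIMSEQ_inverse_real_of_nat[unfolded inverse_eq_divide])
  have "Cauchy y"
  proof (rule metric_CauchyI)
    fix \<epsilon> :: real assume "\<epsilon> > 0"
    then have "eventually (\<lambda>n. e n < \<epsilon>\<^sup>2 / 8) sequentially"
      by (intro order_tendstoD(2)[OF e0]) auto
    then obtain N where N: "\<And>n. n \<ge> N \<Longrightarrow> e n < \<epsilon>\<^sup>2 / 8" by (auto simp: eventually_sequentially)
    show "\<exists>M. \<forall>m\<ge>M. \<forall>n\<ge>M. dist (y m) (y n) < \<epsilon>"
    proof (intro exI[of _ N] allI impI)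
      fix a b assume "N \<le> a" "N \<le> b"
      then have "(norm (y a - y b))\<^sup>2 < \<epsilon>\<^sup>2" using mid[of a b] N[of a] N[of b] by simp
      then show "dist (y a) (y b) < \<epsilon>"
        unfolding dist_norm by (rule power2_less_imp_less) (use \<open>\<epsilon> > 0\<close> in simp)
    qed
  qed
  then obtain p where p: "y \<longlonglongrightarrow> p" using Cauchy_convergent convergent_def by blast
  have "(\<lambda>n. m + e n - q (y n)) \<longlonglongrightarrow> m + 0 - q p"
    unfolding q_def by (intro tendsto_intros p e0)
  then have "f p \<le> ereal (m + 0 - q p)"
    by (intro Gamma0_tendsto_le[OF f _ p _, of "\<lambda>n. m + e n - q (y n)"]) (auto simp: y)
  moreover have "ereal (m - q z) \<le> f z" for z
  proof (cases "f z")
    case (real b)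
    then have "b + q z \<in> M" by (auto simp: M_def intro!: exI[of _ z])
    from m_le[OF this] show ?thesis by (simp add: real)
  qed (use Gamma0_not_minfty[OF f, of z] in auto)
  ultimately show thesis using that[of p m] by (simp add: q_def)
qed

text \<open>
  The direction from minimizers to subgradients compares \<open>p\<close> with the points of the segment towards
  \<open>y\<close>: the quadratic terms agree to first order in the parameter \<open>t\<close> of the segment.
\<close>

lemma minimizer_iff_subgradient:
  fixes f :: "'a::real_inner \<Rightarrow> ereal"
  assumes f: "f \<in> Gamma0"
  shows "p \<in> minimizers (\<lambda>y. f y + ereal (1/2 * (norm (x - y))\<^sup>2)) \<longleftrightarrow> subgradient f p (x - p)"
    (is "?L \<longleftrightarrow> ?R")
proof
  assume ?R
  have "f p + ereal (1/2 * (norm (x - p))\<^sup>2) \<le> f y + ereal (1/2 * (norm (x - y))\<^sup>2)" for y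
  proof -
    obtain v where v: "f p = ereal v" using subgradient_finite[OF f \<open>?R\<close>] .
    have "(x - p) \<bullet> (y - p) + 1/2 * (norm (x - y))\<^sup>2 - 1/2 * (norm (x - p))\<^sup>2 = 1/2 * (norm (y - p))\<^sup>2"
      unfolding power2_norm_eq_inner by (simp add: inner_simps inner_commute algebra_simps)
    then have "1/2 * (norm (x - p))\<^sup>2 \<le> (x - p) \<bullet> (y - p) + 1/2 * (norm (x - y))\<^sup>2"
      using zero_le_power2[of "norm (y - p)"] by linarith
    moreover have "f p + ereal ((x - p) \<bullet> (y - p)) \<le> f y"
      using \<open>?R\<close> by (simp add: subgradient_def)
    ultimately show ?thesis by (cases "f y") (auto simp: v)
  qed
  then show ?L by (auto simp: minimizers_def is_arg_min_def not_less)
next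
  assume ?L
  then have le: "f p + ereal (1/2 * (norm (x - p))\<^sup>2) \<le> f y + ereal (1/2 * (norm (x - y))\<^sup>2)" for y
    by (auto simp: minimizers_def is_arg_min_def not_less)
  obtain x0 v0 where x0: "f x0 = ereal v0" using Gamma0_proper[OF f] .
  obtain v where v: "f p = ereal v"
    using le[of x0] x0 Gamma0_not_minfty[OF f, of p] by (cases "f p") auto
  show ?R unfolding subgradient_def
  proof
    fix y
    show "f p + ereal ((x - p) \<bullet> (y - p)) \<le> f y"
    proof (cases "f y")
      case (real b)
      have *: "v + (x - p) \<bullet> (y - p) - b \<le> t / 2 * (norm (y - p))\<^sup>2" if t: "0 < t" "t < 1" for t
      proof -
        define z where "z = t *\<^sub>R y + (1 - t) *\<^sub>R p"
        have "f z \<le> ereal (t * b + (1 - t) * v)"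
          unfolding z_def using t by (intro Gamma0_convexD[OF f]) (auto simp: real v)
        then have "v + 1/2 * (norm (x - p))\<^sup>2 \<le> (t * b + (1 - t) * v) + 1/2 * (norm (x - z))\<^sup>2"
          using le[of z] Gamma0_not_minfty[OF f, of z] by (cases "f z") (auto simp: v)
        moreover have "(norm (x - z))\<^sup>2 = (norm (x - p))\<^sup>2 - 2 * t * ((x - p) \<bullet> (y - p)) + t\<^sup>2 * (norm (y - p))\<^sup>2"
        proof -
          have "x - z = (x - p) - t *\<^sub>R (y - p)" by (simp add: z_def algebra_simps)
          moreover have "(norm (v - t *\<^sub>R w))\<^sup>2 = (norm v)\<^sup>2 - 2 * t * (v \<bullet> w) + t\<^sup>2 * (norm w)\<^sup>2" for v w :: 'a
            unfolding power2_norm_eq_inner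
            by (simp add: inner_diff_left inner_diff_right inner_commute power2_eq_square algebra_simps)
          ultimately show ?thesis by metis
        qed
        ultimately have "t * (v + (x - p) \<bullet> (y - p) - b) \<le> t * (t / 2 * (norm (y - p))\<^sup>2)"
          by (simp add: algebra_simps power2_eq_square)
        then show ?thesis using t by simp
      qed
      have "v + (x - p) \<bullet> (y - p) - b \<le> 0"
      proof (rule tendsto_lowerbound)
        show "((\<lambda>t. t / 2 * (norm (y - p))\<^sup>2) \<longlongrightarrow> 0) (at_right 0)"
          by (auto intro!: tendsto_eq_intros)
        show "eventually (\<lambda>t. v + (x - p) \<bullet> (y - p) - b \<le> t / 2 * (norm (y - p))\<^sup>2) (at_right 0)"
          using * by (auto simp: eventually_at_right_field intro!: exI[of _ 1])
      qed simp
      then show ?thesis by (simp add: v real)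
    qed (use Gamma0_not_minfty[OF f, of y] in auto)
  qed
qed

text \<open>
  The two parts together say that the proximity operator is the resolvent of the subdifferential.
  Uniqueness of the minimizer, on which the definition of \<open>prox\<close> by description depends, is
  monotonicity of subgradients.
\<close>

lemma prox_subgradient:
  fixes f :: "'a::{real_inner, complete_space} \<Rightarrow> ereal"
  assumes f: "f \<in> Gamma0"
  shows "subgradient f (prox f x) (x - prox f x)"
    and "subgradient f p (x - p) \<Longrightarrow> prox f x = p"
proof -
  have uniq: "p = q" if "subgradient f p (x - p)" "subgradient f q (x - q)" for p q
  proof -
    have "0 \<le> ((x - p) - (x - q)) \<bullet> (p - q)" using subgradient_monotone[OF f that] .
    also have "\<dots> = - ((p - q) \<bullet> (p - q))" by (simp add: algebra_simps inner_simps)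
    finally have "(p - q) \<bullet> (p - q) \<le> 0" by simp
    then show "p = q" using inner_gt_zero_iff[of "p - q"] by fastforce
  qed
  obtain p0 and m :: real where pm: "f p0 \<le> ereal (m - 1/2 * (norm (x - p0))\<^sup>2)"
    "\<And>y. ereal (m - 1/2 * (norm (x - y))\<^sup>2) \<le> f y"
    using Gamma0_prox_exists[OF f] by metis
  have "f p0 + ereal (1/2 * (norm (x - p0))\<^sup>2) \<le> f y + ereal (1/2 * (norm (x - y))\<^sup>2)" for y
    using pm(1) pm(2)[of y] Gamma0_not_minfty[OF f, of p0]
    by (cases "f p0"; cases "f y") auto
  then have "p0 \<in> minimizers (\<lambda>y. f y + ereal (1/2 * (norm (x - y))\<^sup>2))"
    by (auto simp: minimizers_def is_arg_min_def not_less)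
  then have p: "subgradient f p0 (x - p0)" using minimizer_iff_subgradient[OF f] by blast
  have prox: "prox f x = q" if "subgradient f q (x - q)" for q
    unfolding prox_def minimizer_iff_subgradient[OF f] using uniq that by blast
  show "subgradient f (prox f x) (x - prox f x)" using p prox by metis
  show "subgradient f p (x - p) \<Longrightarrow> prox f x = p" by (rule prox)
qed

section \<open>Projections, the Riesz representation and weak limits\<close>

lemma indicator_Gamma0:
  fixes C :: "'a::real_normed_vector set"
  assumes "closed C" "convex C" "C \<noteq> {}"
  shows "(\<lambda>x. if x \<in> C then 0 else \<infinity>) \<in> Gamma0" (is "?g \<in> _")
proof -
  have "?g x \<le> Liminf (nhds x) ?g" for x
  proof (cases "x \<in> C")
    case True
    then show ?thesis by (simp add: Liminf_bounded)
  next
    case False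
    then have "eventually (\<lambda>z. z \<in> - C) (nhds x)"
      using assms(1) by (intro eventually_nhds_in_open) (auto simp: open_Compl)
    then have "eventually (\<lambda>z. \<infinity> \<le> ?g z) (nhds x)" by eventually_elim simp
    then have "\<infinity> \<le> Liminf (nhds x) ?g" by (rule Liminf_bounded)
    then show ?thesis using False by simp
  qed
  moreover have "econvex ?g"
    unfolding econvex_def
  proof (intro allI ballI)
    fix x y :: 'a and t :: real assume t: "t \<in> {0<..<1}"
    then have "t *\<^sub>R x + (1 - t) *\<^sub>R y \<in> C" if "x \<in> C" "y \<in> C"
      using convexD[OF assms(2) that, of t "1 - t"] by simp
    with t show "?g (t *\<^sub>R x + (1 - t) *\<^sub>R y) \<le> ereal t * ?g x + ereal (1 - t) * ?g y" by auto
  qed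
  moreover have "edom ?g \<noteq> {}" using assms(3) by (auto simp: edom_def)
  ultimately show ?thesis by (auto simp: Gamma0_def lsc_def)
qed

text \<open>
  The projection is the proximity operator of the indicator function, and its variational
  characterization is the subgradient inequality.
\<close>

lemma projection_exists:
  fixes C :: "'a::{real_inner, complete_space} set"
  assumes "closed C" "convex C" "C \<noteq> {}"
  obtains p where "p \<in> C" "\<And>c. c \<in> C \<Longrightarrow> (x - p) \<bullet> (c - p) \<le> 0"
proof -
  let ?g = "\<lambda>x. if x \<in> C then 0 else \<infinity> :: ereal"
  have g: "?g \<in> Gamma0" by (rule indicator_Gamma0[OF assms])
  define p where "p = prox ?g x"
  have s: "subgradient ?g p (x - p)" unfolding p_def by (rule prox_subgradient[OF g])
  have p: "p \<in> C" using subgradient_finite[OF g s] by (metis PInfty_neq_ereal(1))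
  show thesis
  proof (rule that[OF p])
    fix c assume "c \<in> C"
    then show "(x - p) \<bullet> (c - p) \<le> 0"
      using s[unfolded subgradient_def, rule_format, of c] p by (simp add: zero_ereal_def)
  qed
qed

text \<open>
  The function \<open>1/2 \<parallel>y\<parallel>\<^sup>2 - \<phi> y\<close> has a minimizer, at which its gradient vanishes.
\<close>

lemma riesz_representation:
  fixes \<phi> :: "'a::{real_inner, complete_space} \<Rightarrow> real"
  assumes "bounded_linear \<phi>"
  obtains z where "\<And>y. \<phi> y = z \<bullet> y"
proof -
  interpret bounded_linear \<phi> by fact
  let ?g = "\<lambda>y. ereal (- \<phi> y)"
  have "?g x \<le> Liminf (nhds x) ?g" for x
  proof -
    have "(?g \<longlongrightarrow> ?g x) (nhds x)"
      unfolding tendsto_at_iff_tendsto_nhds[symmetric]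
      by (intro tendsto_intros tendsto filterlim_ident)
    from lim_imp_Liminf[OF _ this] show ?thesis by simp
  qed
  then have g: "?g \<in> Gamma0"
    by (auto simp: Gamma0_def lsc_def edom_def econvex_def add diff scaleR algebra_simps)
  define z where "z = - prox ?g 0"
  have s: "\<And>y. ?g (- z) + ereal (z \<bullet> (y + z)) \<le> ?g y"
    using prox_subgradient(1)[OF g, of 0] unfolding subgradient_def z_def by simp
  have le: "\<phi> h \<le> - z \<bullet> h" for h
    using s[of "h - z"] by (simp add: diff neg)
  show thesis
  proof (rule that[of "- z"])
    fix y
    show "\<phi> y = - z \<bullet> y" using le[of y] le[of "- y"] by (simp add: neg)
  qed
qed

text \<open>
  Send \<open>n\<close> to the functional \<open>\<lambda>u. y n \<bullet> u\<close>. By the Cauchy-Schwarz inequality these functionals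
  lie in a product of compact intervals, so by Tychonoff's theorem they have a pointwise cluster
  point. It is again linear and bounded, and Riesz represents it by a vector.
\<close>

lemma weak_cluster_point:
  fixes y :: "'b \<Rightarrow> 'a::{real_inner, complete_space}"
  assumes F: "F \<noteq> bot" and bd: "eventually (\<lambda>n. norm (y n) \<le> B) F"
  obtains F' z where "F' \<le> F" "F' \<noteq> bot" "\<And>u. ((\<lambda>n. y n \<bullet> u) \<longlongrightarrow> z \<bullet> u) F'"
proof -
  define g where "g n = (\<lambda>u. y n \<bullet> u)" for n
  define K where "K = Pi\<^sub>E UNIV (\<lambda>u::'a. {- (B * norm u)..B * norm u})"
  have "compactin (product_topology (\<lambda>u. euclidean) UNIV) K"
    unfolding K_def by (subst compactin_PiE) auto
  then have K: "compact K" by (simp add: euclidean_product_topology)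
  have "eventually (\<lambda>v. v \<in> K) (filtermap g F)"
    unfolding eventually_filtermap using bd
  proof eventually_elim
    case (elim n)
    have "\<bar>y n \<bullet> u\<bar> \<le> B * norm u" for u
      using Cauchy_Schwarz_ineq2[of "y n" u] mult_right_mono[OF elim norm_ge_zero[of u]] by linarith
    then show ?case by (auto simp: K_def g_def abs_le_iff minus_le_iff)
  qed
  moreover have "filtermap g F \<noteq> bot" using F by (simp add: filtermap_bot_iff)
  ultimately obtain \<phi> where \<phi>: "\<phi> \<in> K" "inf (nhds \<phi>) (filtermap g F) \<noteq> bot"
    using K unfolding compact_filter by blast
  \<comment> \<open>The indices whose functionals approach \<open>\<phi>\<close>, within \<open>F\<close>.\<close>
  define F' where "F' = inf F (filtercomap g (nhds \<phi>))"
  have F'F: "F' \<le> F" by (simp add: F'_def)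
  have F': "F' \<noteq> bot"
  proof
    assume "F' = bot"
    then have "eventually (\<lambda>_. False) F'" by simp
    then obtain P Q where PQ: "eventually P F" "eventually Q (filtercomap g (nhds \<phi>))"
      "\<And>n. P n \<Longrightarrow> Q n \<Longrightarrow> False" unfolding F'_def eventually_inf by auto
    then obtain R where R: "eventually R (nhds \<phi>)" "\<And>n. R (g n) \<Longrightarrow> Q n"
      unfolding eventually_filtercomap by auto
    have "eventually (\<lambda>v. \<exists>n. P n \<and> v = g n) (filtermap g F)"
      unfolding eventually_filtermap using PQ(1) by eventually_elim auto
    then have "eventually (\<lambda>_. False) (inf (nhds \<phi>) (filtermap g F))"
      unfolding eventually_inf using R PQ(3) by blast
    with \<phi>(2) show False by simp
  qed
  have "filterlim g (nhds \<phi>) F'"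
    unfolding F'_def filterlim_def by (metis filtermap_filtercomap filtermap_mono inf_le2 order_trans)
  then have "((\<lambda>n. g n u) \<longlongrightarrow> \<phi> u) F'" for u
  proof (intro topological_tendstoI)
    fix S assume S: "open S" "\<phi> u \<in> S"
    have "open ((\<lambda>v::'a \<Rightarrow> real. v u) -` S)"
      by (intro open_vimage S continuous_on_product_coordinates)
    then have "eventually (\<lambda>v. v \<in> (\<lambda>v. v u) -` S) (nhds \<phi>)"
      using S by (intro eventually_nhds_in_open) auto
    then have "eventually (\<lambda>n. g n \<in> (\<lambda>v. v u) -` S) F'"
      using \<open>filterlim g (nhds \<phi>) F'\<close> by (auto simp: filterlim_iff)
    then show "eventually (\<lambda>n. g n u \<in> S) F'" by simp
  qed
  then have t: "((\<lambda>n. y n \<bullet> u) \<longlongrightarrow> \<phi> u) F'" for u by (simp add: g_def)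
  have "bounded_linear \<phi>"
  proof (rule bounded_linear_intro)
    show "\<phi> (u + v) = \<phi> u + \<phi> v" for u v
      using tendsto_unique[OF F' t[of "u + v"]] tendsto_add[OF t[of u] t[of v]]
      by (simp add: inner_add_right)
    show "\<phi> (r *\<^sub>R u) = r *\<^sub>R \<phi> u" for r u
      using tendsto_unique[OF F' t[of "r *\<^sub>R u"]] tendsto_mult_left[OF t[of u], of r] by simp
    show "norm (\<phi> u) \<le> norm u * B" for u
    proof -
      have "\<phi> u \<in> {- (B * norm u)..B * norm u}" using \<phi>(1) by (auto simp: K_def)
      then show ?thesis by (auto simp: abs_le_iff mult.commute)
    qed
  qed
  then obtain z where "\<And>u. \<phi> u = z \<bullet> u" using riesz_representation by blast
  with that[OF F'F F'] t show thesis by auto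
qed

text \<open>
  The inequality characterizing the projection of \<open>z\<close> onto \<open>C\<close> is linear in the point of \<open>C\<close>, hence
  passes to the weak limit \<open>z\<close> itself, which therefore coincides with its projection.
\<close>

lemma weak_limit_in_closed_convex:
  fixes C :: "'a::{real_inner, complete_space} set"
  assumes C: "closed C" "convex C" and F: "F \<noteq> bot"
    and ev: "eventually (\<lambda>n. y n \<in> C) F"
    and w: "\<And>u. ((\<lambda>n. y n \<bullet> u) \<longlongrightarrow> z \<bullet> u) F"
  shows "z \<in> C"
proof -
  have "C \<noteq> {}" using ev F by (auto simp: eventually_False)
  then obtain p where p: "p \<in> C" "\<And>c. c \<in> C \<Longrightarrow> (z - p) \<bullet> (c - p) \<le> 0"
    using projection_exists[OF C] by metis
  have "((\<lambda>n. y n \<bullet> (z - p) - p \<bullet> (z - p)) \<longlongrightarrow> z \<bullet> (z - p) - p \<bullet> (z - p)) F"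
    by (intro tendsto_intros w)
  moreover have "eventually (\<lambda>n. y n \<bullet> (z - p) - p \<bullet> (z - p) \<le> 0) F"
    using ev
  proof eventually_elim
    case (elim n)
    from p(2)[OF elim] show ?case by (simp add: inner_diff_right inner_commute)
  qed
  ultimately have "z \<bullet> (z - p) - p \<bullet> (z - p) \<le> 0"
    using tendsto_upperbound F by blast
  then have "(z - p) \<bullet> (z - p) \<le> 0" by (simp add: inner_diff_left)
  then show ?thesis using p(1) inner_gt_zero_iff[of "z - p"] by fastforce
qed

text \<open>
  Coercivity keeps a minimizing sequence in a ball. Sublevel sets are closed and convex, so a weak
  cluster point stays in all those whose level exceeds the infimum.
\<close>

lemma Gamma0_coercive_minimizer_exists:
  fixes g :: "'a::{real_inner, complete_space} \<Rightarrow> ereal"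
  assumes g: "g \<in> Gamma0" and coercive: "(g \<longlongrightarrow> \<infinity>) at_infinity"
  shows "minimizers g \<noteq> {}"
proof -
  obtain x0 v0 where x0: "g x0 = ereal v0" using Gamma0_proper[OF g] .
  have "eventually (\<lambda>x. ereal v0 < g x) at_infinity"
    using coercive by (auto intro: order_tendstoD)
  then obtain R where R: "\<And>x. R \<le> norm x \<Longrightarrow> ereal v0 < g x" by (auto simp: eventually_at_infinity)
  obtain c d where cd: "d \<ge> 0" "\<And>y. ereal (c - d * norm y) \<le> g y"
    using Gamma0_lower_bound[OF g] by metis
  define M where "M = {s. \<exists>y. g y \<le> ereal s}"
  have v0M: "v0 \<in> M" using x0 by (auto simp: M_def intro!: exI[of _ x0])
  have "min v0 (c - d * R) \<le> s" if "s \<in> M" for s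
  proof -
    obtain y where y: "g y \<le> ereal s" using \<open>s \<in> M\<close> by (auto simp: M_def)
    show ?thesis
    proof (cases "R \<le> norm y")
      case True
      have "ereal v0 < ereal s" using R[OF True] y by (rule less_le_trans)
      then show ?thesis by simp
    next
      case False
      have "ereal (c - d * norm y) \<le> ereal s" using cd(2) y by (rule order_trans)
      moreover have "d * norm y \<le> d * R" using False cd(1) by (intro mult_left_mono) auto
      ultimately show ?thesis by simp
    qed
  qed
  then have bdd: "bdd_below M" by (auto simp: bdd_below_def)
  define m where "m = Inf M"
  have m_le: "m \<le> s" if "s \<in> M" for s unfolding m_def by (rule cInf_lower[OF that bdd])
  define B where "B = max R (norm x0)"
  define e where "e n = 1 / real (Suc n)" for n
  \<comment> \<open>An almost minimizing point outside the ball of radius \<open>R\<close> is worse than \<open>x0\<close>, which can replace it.\<close>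
  have "\<exists>y. norm y \<le> B \<and> g y \<le> ereal (m + e n)" for n
  proof -
    have "Inf M < m + e n" by (simp add: m_def e_def)
    then obtain s where s: "s \<in> M" "s < m + e n" using v0M cInf_lessD by blast
    then obtain y where y: "g y \<le> ereal s" by (auto simp: M_def)
    show ?thesis
    proof (cases "R \<le> norm y")
      case True
      have "ereal v0 < ereal s" using R[OF True] y by (rule less_le_trans)
      then show ?thesis using s(2) by (intro exI[of _ x0]) (auto simp: x0 B_def)
    next
      case False
      have "g y \<le> ereal (m + e n)" using y s(2) by (simp add: order_trans)
      then show ?thesis using False by (intro exI[of _ y]) (auto simp: B_def)
    qed
  qed
  then obtain y where y: "\<And>n. norm (y n) \<le> B" "\<And>n. g (y n) \<le> ereal (m + e n)" by metis
  obtain F z where F: "F \<le> sequentially" "F \<noteq> bot" "\<And>u. ((\<lambda>n. y n \<bullet> u) \<longlongrightarrow> z \<bullet> u) F"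
    using weak_cluster_point[of sequentially y B] y(1) by auto
  have le: "g z \<le> ereal (m + e n)" for n
  proof -
    have "z \<in> {x. g x \<le> ereal (m + e n)}"
    proof (rule weak_limit_in_closed_convex[OF Gamma0_sublevel_closed[OF g] Gamma0_sublevel_convex[OF g] F(2) _ F(3)])
      have "eventually (\<lambda>k. n \<le> k) F" using F(1) eventually_ge_at_top filter_leD by blast
      then show "eventually (\<lambda>k. y k \<in> {x. g x \<le> ereal (m + e n)}) F"
      proof eventually_elim
        case (elim k)
        have "e k \<le> e n" using elim by (auto simp: e_def divide_simps)
        then have "ereal (m + e k) \<le> ereal (m + e n)" by simp
        with y(2)[of k] show ?case by (auto intro: order_trans)
      qed
    qed
    then show ?thesis by simp
  qed
  have "(\<lambda>n. m + e n) \<longlonglongrightarrow> m + 0"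
    unfolding e_def by (intro tendsto_intros LIMSEQ_inverse_real_of_nat[unfolded inverse_eq_divide])
  then have "g z \<le> ereal (m + 0)"
    by (intro Gamma0_tendsto_le[OF g sequentially_bot, of "\<lambda>_. z"]) (auto simp: le)
  moreover have "ereal m \<le> g x" for x
  proof (cases "g x")
    case (real b)
    then have "b \<in> M" by (auto simp: M_def intro!: exI[of _ x])
    from m_le[OF this] show ?thesis by (simp add: real)
  qed (use Gamma0_not_minfty[OF g, of x] in auto)
  ultimately have "g z \<le> g x" for x by (simp add: order_trans)
  then show ?thesis by (auto simp: minimizers_def is_arg_min_def not_less)
qed

section \<open>Krasnoselskii-Mann iterations with errors\<close>

text \<open>
  Subtracting the accumulated errors gives a decreasing sequence that is bounded below.
\<close>

lemma quasi_decreasing_convergent: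
  fixes a \<epsilon> :: "nat \<Rightarrow> real"
  assumes a: "\<And>n. 0 \<le> a n" and \<epsilon>: "\<And>n. 0 \<le> \<epsilon> n" "summable \<epsilon>"
    and step: "\<And>n. a (Suc n) \<le> a n + \<epsilon> n"
  obtains L where "a \<longlonglongrightarrow> L"
proof -
  define b where "b n = a n - sum \<epsilon> {..<n}" for n
  have "decseq b" unfolding decseq_Suc_iff using step by (simp add: b_def algebra_simps)
  moreover have "- suminf \<epsilon> \<le> b n" for n
    using sum_le_suminf[OF \<epsilon>(2), of "{..<n}"] a[of n] \<epsilon>(1) by (simp add: b_def)
  ultimately obtain L where L: "b \<longlonglongrightarrow> L" using decseq_convergent by metis
  have "(\<lambda>n. b n + sum \<epsilon> {..<n}) \<longlonglongrightarrow> L + suminf \<epsilon>"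
    by (intro tendsto_add L summable_LIMSEQ \<epsilon>)
  then show thesis using that by (simp add: b_def)
qed

lemma norm_convex_combination:
  fixes u v :: "'h::real_inner"
  shows "(norm ((1 - t) *\<^sub>R u + t *\<^sub>R v))\<^sup>2
    = (1 - t) * (norm u)\<^sup>2 + t * (norm v)\<^sup>2 - t * (1 - t) * (norm (u - v))\<^sup>2"
  unfolding power2_norm_eq_inner by (simp add: inner_simps inner_commute algebra_simps)

text \<open>
  Expanding \<open>\<parallel>y n - R z\<parallel>\<^sup>2\<close> around \<open>z\<close> gives \<open>\<parallel>y n - z\<parallel>\<^sup>2 + \<parallel>z - R z\<parallel>\<^sup>2\<close> up to a term that
  vanishes in the weak limit, while nonexpansiveness bounds it by \<open>\<parallel>y n - z\<parallel>\<^sup>2\<close> up to the residual.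
\<close>

lemma demiclosedness_principle:
  fixes R :: "'h::real_inner \<Rightarrow> 'h"
  assumes nonexp: "\<And>u v. norm (R u - R v) \<le> norm (u - v)"
    and F: "F \<noteq> bot" and bd: "eventually (\<lambda>n. norm (y n) \<le> B) F"
    and w: "\<And>u. ((\<lambda>n. y n \<bullet> u) \<longlongrightarrow> z \<bullet> u) F"
    and res: "((\<lambda>n. norm (R (y n) - y n)) \<longlongrightarrow> 0) F"
  shows "R z = z"
proof -
  let ?d = "\<lambda>n. norm (R (y n) - y n)"
  let ?b = "\<lambda>n. (?d n)\<^sup>2 + 2 * ?d n * (B + norm z) - 2 * (y n \<bullet> (z - R z) - z \<bullet> (z - R z))"
  have "(?b \<longlongrightarrow> 0\<^sup>2 + 2 * 0 * (B + norm z) - 2 * (z \<bullet> (z - R z) - z \<bullet> (z - R z))) F"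
    by (intro tendsto_intros res w)
  moreover have "eventually (\<lambda>n. (norm (z - R z))\<^sup>2 \<le> ?b n) F"
    using bd
  proof eventually_elim
    case (elim n)
    have "norm (y n - R z) \<le> ?d n + norm (R (y n) - R z)"
      using norm_triangle_ineq[of "y n - R (y n)" "R (y n) - R z"] by (simp add: norm_minus_commute)
    also have "\<dots> \<le> ?d n + norm (y n - z)" using nonexp[of "y n" z] by simp
    finally have "(norm (y n - R z))\<^sup>2 \<le> (?d n + norm (y n - z))\<^sup>2" by (simp add: power_mono)
    moreover have "(norm (y n - R z))\<^sup>2 = (norm (y n - z))\<^sup>2 + (norm (z - R z))\<^sup>2
        + 2 * (y n \<bullet> (z - R z) - z \<bullet> (z - R z))"
      unfolding power2_norm_eq_inner by (simp add: inner_diff_left inner_diff_right inner_commute algebra_simps)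
    moreover have "?d n * norm (y n - z) \<le> ?d n * (B + norm z)"
      using norm_triangle_ineq4[of "y n" z] elim by (intro mult_left_mono) auto
    ultimately show ?case by (simp add: power2_sum algebra_simps)
  qed
  ultimately have "(norm (z - R z))\<^sup>2 \<le> 0" using tendsto_lowerbound F by fastforce
  then show ?thesis by simp
qed

text \<open>
  Divergence of the sum of \<open>\<mu> n * (1 - \<mu> n)\<close> by itself only makes the residual \<open>R (y n) - y n\<close>
  small along a subsequence. The residual norms have a limit because they are decreasing up to
  summable errors, so that limit is zero. Opial's argument then runs on filters: \<open>uniq\<close> applies to
  the cluster points along arbitrary filters finer than \<open>sequentially\<close>, and if weak convergence
  failed, the indices at which it fails would give such a filter with another cluster point.
\<close>

theorem krasnoselskii_mann:
  fixes R :: "'h::{real_inner, complete_space} \<Rightarrow> 'h" and y e :: "nat \<Rightarrow> 'h" and \<mu> :: "nat \<Rightarrow> real"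
  assumes nonexp: "\<And>u v. norm (R u - R v) \<le> norm (u - v)"
    and fixpt: "R q = q"
    and \<mu>: "\<And>n. \<mu> n \<in> {0..1}"
    and step: "\<And>n. y (Suc n) = y n + \<mu> n *\<^sub>R (R (y n) - y n) + e n"
    and e: "summable (\<lambda>n. norm (e n))"
    and \<mu>_sum: "filterlim (\<lambda>N. \<Sum>n<N. \<mu> n * (1 - \<mu> n)) at_top sequentially"
  obtains z where "R z = z" "\<And>u. (\<lambda>n. y n \<bullet> u) \<longlonglongrightarrow> z \<bullet> u"
proof -
  define r where "r n = norm (R (y n) - y n)" for n
  \<comment> \<open>The exact step; the iterate differs from it by the error.\<close>
  define z where "z n = y n + \<mu> n *\<^sub>R (R (y n) - y n)" for n
  have y_Suc: "y (Suc n) = z n + e n" for n by (simp add: step z_def)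
  have z_sq: "(norm (z n - p))\<^sup>2 \<le> (norm (y n - p))\<^sup>2 - \<mu> n * (1 - \<mu> n) * (r n)\<^sup>2" if "R p = p" for p n
  proof -
    have "z n - p = (1 - \<mu> n) *\<^sub>R (y n - p) + \<mu> n *\<^sub>R (R (y n) - p)"
      by (simp add: z_def algebra_simps)
    then have eq: "(norm (z n - p))\<^sup>2 = (1 - \<mu> n) * (norm (y n - p))\<^sup>2 + \<mu> n * (norm (R (y n) - p))\<^sup>2
        - \<mu> n * (1 - \<mu> n) * (r n)\<^sup>2"
      by (simp add: norm_convex_combination r_def norm_minus_commute)
    have "(norm (R (y n) - p))\<^sup>2 \<le> (norm (y n - p))\<^sup>2"
      using nonexp[of "y n" p] that by (simp add: power_mono)
    then have "\<mu> n * (norm (R (y n) - p))\<^sup>2 \<le> \<mu> n * (norm (y n - p))\<^sup>2"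
      using \<mu>[of n] by (intro mult_left_mono) auto
    then show ?thesis using eq by (simp add: algebra_simps)
  qed
  have z_le: "norm (z n - p) \<le> norm (y n - p)" if "R p = p" for p n
  proof (rule power2_le_imp_le)
    have "0 \<le> \<mu> n * (1 - \<mu> n) * (r n)\<^sup>2" using \<mu>[of n] by simp
    then show "(norm (z n - p))\<^sup>2 \<le> (norm (y n - p))\<^sup>2" using z_sq[OF that, of n] by linarith
  qed simp
  \<comment> \<open>Quasi-Fejer monotonicity: the distance to a fixed point grows by at most the error.\<close>
  have fejer: "norm (y (Suc n) - p) \<le> norm (y n - p) + norm (e n)" if "R p = p" for p n
    using norm_triangle_ineq[of "z n - p" "e n"] z_le[OF that, of n]
    by (simp add: y_Suc algebra_simps)
  have dist_conv: "\<exists>L. (\<lambda>n. norm (y n - p)) \<longlonglongrightarrow> L" if "R p = p" for p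
    using quasi_decreasing_convergent[of "\<lambda>n. norm (y n - p)" "\<lambda>n. norm (e n)"] fejer[OF that] e
    by auto
  have "Bseq (\<lambda>n. norm (y n - q))" using dist_conv[OF fixpt] convergent_def convergent_imp_Bseq by blast
  then obtain B where B: "B > 0" "\<And>n. norm (y n - q) \<le> B" by (auto simp: Bseq_def)
  have "Bseq (\<lambda>n. norm (e n))" using summable_LIMSEQ_zero[OF e] convergent_def convergent_imp_Bseq by blast
  then obtain E where E: "E > 0" "\<And>n. norm (e n) \<le> E" by (auto simp: Bseq_def)
  have r_step: "r (Suc n) \<le> r n + 2 * norm (e n)" for n
  proof -
    have "r (Suc n) \<le> norm (R (z n + e n) - R (z n)) + norm (R (z n) - z n) + norm (e n)"
      unfolding r_def y_Suc by (rule order_trans[OF _ add_right_mono[OF norm_triangle_ineq]],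
          rule order_trans[OF _ norm_triangle_ineq4]) (simp add: algebra_simps)
    also have "\<dots> \<le> norm (R (z n) - z n) + 2 * norm (e n)" using nonexp[of "z n + e n" "z n"] by simp
    also have "norm (R (z n) - z n) \<le> norm (R (z n) - R (y n)) + norm (R (y n) - z n)"
      using norm_triangle_ineq[of "R (z n) - R (y n)" "R (y n) - z n"] by simp
    also have "norm (R (z n) - R (y n)) \<le> norm (z n - y n)" by (rule nonexp)
    also have "norm (z n - y n) = \<mu> n * r n" using \<mu>[of n] by (simp add: z_def r_def)
    also have "norm (R (y n) - z n) = (1 - \<mu> n) * r n"
    proof -
      have "R (y n) - z n = (1 - \<mu> n) *\<^sub>R (R (y n) - y n)" by (simp add: z_def algebra_simps)
      then show ?thesis using \<mu>[of n] by (simp add: r_def)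
    qed
    finally show ?thesis by (simp add: algebra_simps)
  qed
  obtain \<rho> where \<rho>: "r \<longlonglongrightarrow> \<rho>"
    using quasi_decreasing_convergent[of r "\<lambda>n. 2 * norm (e n)"] r_step e
    by (auto simp: r_def intro: summable_mult)
  define C where "C = 2 * B + E"
  have sq_step: "\<mu> n * (1 - \<mu> n) * (r n)\<^sup>2 \<le> (norm (y n - q))\<^sup>2 - (norm (y (Suc n) - q))\<^sup>2 + C * norm (e n)" for n
  proof -
    have "norm (y (Suc n) - q) \<le> norm (z n - q) + norm (e n)"
      using norm_triangle_ineq[of "z n - q" "e n"] by (simp add: y_Suc algebra_simps)
    then have "(norm (y (Suc n) - q))\<^sup>2 \<le> (norm (z n - q) + norm (e n))\<^sup>2" by (simp add: power_mono)
    also have "\<dots> = (norm (z n - q))\<^sup>2 + (2 * norm (z n - q) + norm (e n)) * norm (e n)"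
      by (simp add: power2_eq_square algebra_simps)
    also have "(2 * norm (z n - q) + norm (e n)) * norm (e n) \<le> C * norm (e n)"
      unfolding C_def using z_le[OF fixpt, of n] B(2)[of n] E(2)[of n] by (intro mult_right_mono) auto
    finally show ?thesis using z_sq[OF fixpt, of n] by simp
  qed
  define S where "S = (norm (y 0 - q))\<^sup>2 + C * (\<Sum>n. norm (e n))"
  have sum_le: "(\<Sum>n<N. \<mu> n * (1 - \<mu> n) * (r n)\<^sup>2) \<le> S" for N
  proof -
    have "(\<Sum>n<N. \<mu> n * (1 - \<mu> n) * (r n)\<^sup>2)
        \<le> (\<Sum>n<N. ((norm (y n - q))\<^sup>2 - (norm (y (Suc n) - q))\<^sup>2) + C * norm (e n))"
      by (intro sum_mono sq_step)
    also have "\<dots> = (norm (y 0 - q))\<^sup>2 - (norm (y N - q))\<^sup>2 + C * (\<Sum>n<N. norm (e n))"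
      by (simp add: sum.distrib sum_distrib_left
          sum_lessThan_telescope'[of "\<lambda>n. (norm (y n - q))\<^sup>2" N])
    also have "C * (\<Sum>n<N. norm (e n)) \<le> C * (\<Sum>n. norm (e n))"
      using B E by (intro mult_left_mono sum_le_suminf e) (auto simp: C_def)
    finally show ?thesis unfolding S_def using zero_le_power2[of "norm (y N - q)"] by linarith
  qed
  have "\<rho> \<ge> 0" by (rule tendsto_lowerbound[OF \<rho>]) (auto simp: r_def)
  have "\<rho> = 0"
  proof (rule ccontr)
    assume "\<rho> \<noteq> 0"
    with \<open>\<rho> \<ge> 0\<close> have pos: "\<rho> > 0" by simp
    then have "eventually (\<lambda>n. \<rho> / 2 < r n) sequentially" by (intro order_tendstoD(1)[OF \<rho>]) auto
    then obtain N0 where N0: "\<And>n. n \<ge> N0 \<Longrightarrow> \<rho> / 2 < r n" by (auto simp: eventually_sequentially)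
    define K where "K = (\<Sum>n<N0. \<mu> n * (1 - \<mu> n))"
    have "(\<Sum>n<N. \<mu> n * (1 - \<mu> n)) \<le> K + S / (\<rho> / 2)\<^sup>2" if "N \<ge> N0" for N
    proof -
      have split: "{..<N} = {..<N0} \<union> {N0..<N}" using that by auto
      have "(\<Sum>n<N. \<mu> n * (1 - \<mu> n)) = K + (\<Sum>n\<in>{N0..<N}. \<mu> n * (1 - \<mu> n))"
        unfolding split K_def by (rule sum.union_disjoint) auto
      moreover have "(\<Sum>n\<in>{N0..<N}. \<mu> n * (1 - \<mu> n)) * (\<rho> / 2)\<^sup>2 \<le> S"
      proof -
        have "(\<Sum>n\<in>{N0..<N}. \<mu> n * (1 - \<mu> n)) * (\<rho> / 2)\<^sup>2 \<le> (\<Sum>n\<in>{N0..<N}. \<mu> n * (1 - \<mu> n) * (r n)\<^sup>2)"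
          unfolding sum_distrib_right
        proof (rule sum_mono)
          fix n assume "n \<in> {N0..<N}"
          then have "(\<rho> / 2)\<^sup>2 \<le> (r n)\<^sup>2" using N0[of n] pos by (intro power_mono) auto
          then show "\<mu> n * (1 - \<mu> n) * (\<rho> / 2)\<^sup>2 \<le> \<mu> n * (1 - \<mu> n) * (r n)\<^sup>2"
            using \<mu>[of n] by (intro mult_left_mono) auto
        qed
        also have "\<dots> \<le> (\<Sum>n<N. \<mu> n * (1 - \<mu> n) * (r n)\<^sup>2)"
          using \<mu> by (intro sum_mono2) auto
        finally show ?thesis using sum_le[of N] by simp
      qed
      then have "(\<Sum>n\<in>{N0..<N}. \<mu> n * (1 - \<mu> n)) \<le> S / (\<rho> / 2)\<^sup>2"
        using pos by (simp add: pos_le_divide_eq)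
      ultimately show ?thesis by simp
    qed
    moreover have "eventually (\<lambda>N. K + S / (\<rho> / 2)\<^sup>2 < (\<Sum>n<N. \<mu> n * (1 - \<mu> n))) sequentially"
      using \<mu>_sum by (auto simp: filterlim_at_top_dense)
    ultimately show False
      by (auto simp: eventually_sequentially) (meson leD nle_le)
  qed
  with \<rho> have r0: "r \<longlonglongrightarrow> 0" by simp
  have bd: "norm (y n) \<le> B + norm q" for n
    using norm_triangle_ineq2[of "y n" q] B(2)[of n] by linarith
  have cluster: "\<exists>F' z. F' \<le> F \<and> F' \<noteq> bot \<and> R z = z \<and> (\<forall>u. ((\<lambda>n. y n \<bullet> u) \<longlongrightarrow> z \<bullet> u) F')"
    if F: "F \<noteq> bot" "F \<le> sequentially" for F
  proof -
    obtain F' z where F': "F' \<le> F" "F' \<noteq> bot" "\<And>u. ((\<lambda>n. y n \<bullet> u) \<longlongrightarrow> z \<bullet> u) F'"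
      using weak_cluster_point[OF F(1), of y "B + norm q"] bd by auto
    have "(r \<longlongrightarrow> 0) F'" using r0 F F'(1) by (meson filterlim_mono order_refl order_trans)
    then have "R z = z"
      unfolding r_def
      by (intro demiclosedness_principle[OF nonexp F'(2) _ F'(3), of "B + norm q"]) (auto simp: bd)
    with F' show ?thesis by blast
  qed
  obtain F0 z0 where F0: "F0 \<le> sequentially" "F0 \<noteq> bot" "R z0 = z0"
    "\<And>u. ((\<lambda>n. y n \<bullet> u) \<longlongrightarrow> z0 \<bullet> u) F0"
    using cluster[of sequentially] by auto
  have uniq: "z1 = z0" if F1: "F1 \<le> sequentially" "F1 \<noteq> bot" "R z1 = z1"
    "\<And>u. ((\<lambda>n. y n \<bullet> u) \<longlongrightarrow> z1 \<bullet> u) F1" for F1 z1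
  proof -
    obtain L0 L1 where L: "(\<lambda>n. norm (y n - z0)) \<longlonglongrightarrow> L0" "(\<lambda>n. norm (y n - z1)) \<longlonglongrightarrow> L1"
      using dist_conv F0 F1 by metis
    have "(\<lambda>n. ((norm (y n - z1))\<^sup>2 - (norm (y n - z0))\<^sup>2 + (norm z0)\<^sup>2 - (norm z1)\<^sup>2) / 2)
        \<longlonglongrightarrow> (L1\<^sup>2 - L0\<^sup>2 + (norm z0)\<^sup>2 - (norm z1)\<^sup>2) / 2" (is "_ \<longlonglongrightarrow> ?l")
      by (intro tendsto_intros L) auto
    moreover have "((norm (y n - z1))\<^sup>2 - (norm (y n - z0))\<^sup>2 + (norm z0)\<^sup>2 - (norm z1)\<^sup>2) / 2
        = y n \<bullet> (z0 - z1)" for n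
      unfolding power2_norm_eq_inner by (simp add: inner_diff_left inner_diff_right inner_commute)
    ultimately have l: "(\<lambda>n. y n \<bullet> (z0 - z1)) \<longlonglongrightarrow> ?l" by simp
    have "z0 \<bullet> (z0 - z1) = ?l"
      using tendsto_unique[OF F0(2) F0(4)] l F0(1) by (meson filterlim_mono order_refl)
    moreover have "z1 \<bullet> (z0 - z1) = ?l"
      using tendsto_unique[OF F1(2) F1(4)] l F1(1) by (meson filterlim_mono order_refl)
    ultimately have "(z0 - z1) \<bullet> (z0 - z1) = 0" by (simp add: inner_diff_left)
    then show ?thesis by simp
  qed
  show thesis
  proof (rule that[OF F0(3)])
    fix u
    show "(\<lambda>n. y n \<bullet> u) \<longlonglongrightarrow> z0 \<bullet> u"
    proof (rule ccontr)
      assume "\<not> (\<lambda>n. y n \<bullet> u) \<longlonglongrightarrow> z0 \<bullet> u"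
      then obtain \<epsilon> where \<epsilon>: "\<epsilon> > 0" "\<not> eventually (\<lambda>n. dist (y n \<bullet> u) (z0 \<bullet> u) < \<epsilon>) sequentially"
        by (auto simp: tendsto_iff)
      let ?A = "{n. \<not> dist (y n \<bullet> u) (z0 \<bullet> u) < \<epsilon>}"
      define F where "F = inf sequentially (principal ?A)"
      have "F \<noteq> bot" using \<epsilon>(2) by (auto simp: F_def trivial_limit_def eventually_inf_principal)
      then obtain F1 z1 where F1: "F1 \<le> F" "F1 \<noteq> bot" "R z1 = z1"
        "\<And>u. ((\<lambda>n. y n \<bullet> u) \<longlongrightarrow> z1 \<bullet> u) F1"
        using cluster[of F] by (auto simp: F_def)
      have "z1 = z0" using uniq[OF _ F1(2-)] F1(1) by (simp add: F_def)
      then have "eventually (\<lambda>n. dist (y n \<bullet> u) (z0 \<bullet> u) < \<epsilon>) F1"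
        using F1(4)[of u] \<epsilon>(1) by (auto simp: tendsto_iff)
      moreover have "eventually (\<lambda>n. n \<in> ?A) F1"
        using F1(1) by (auto simp: F_def le_principal)
      ultimately have "eventually (\<lambda>_. False) F1" by eventually_elim simp
      with F1(2) show False by simp
    qed
  qed
qed

section \<open>The subdifferential sum rule under the strong relative interior condition\<close>

text \<open>
  A Hahn-Banach theorem. If \<open>E\<close> is the epigraph of a convex function \<open>h\<close> with
  \<open>- L \<parallel>v\<parallel> \<le> h v\<close>, the conclusion is a linear minorant of \<open>h\<close>. The bound is positively homogeneous
  and closed, so it survives on the closed convex cone generated by \<open>E\<close>. That cone misses
  \<open>(0, -1)\<close>, and projecting this point onto it gives a separating vector with positive last component;
  passing to the cone is what makes the bound hold with no error term.
\<close>

lemma sandwich_affine: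
  fixes E :: "('w::{real_inner, complete_space} \<times> real) set"
  assumes E: "convex E" "E \<noteq> {}" and low: "\<And>v s. (v, s) \<in> E \<Longrightarrow> - (L * norm v) \<le> s"
  obtains w where "\<And>v s. (v, s) \<in> E \<Longrightarrow> w \<bullet> v \<le> s"
proof -
  define K where "K = closure (cone hull E)"
  have K: "closed K" "convex K" "K \<noteq> {}" "cone K"
    using E by (auto simp: K_def convex_cone_hull cone_closure cone_cone_hull cone_hull_empty_iff[symmetric])
  have "K \<subseteq> {k. - (L * norm (fst k)) \<le> snd k}"
    unfolding K_def
  proof (rule closure_minimal)
    show "closed {k :: 'w \<times> real. - (L * norm (fst k)) \<le> snd k}"
      by (intro closed_Collect_le continuous_intros)
    show "cone hull E \<subseteq> {k. - (L * norm (fst k)) \<le> snd k}"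
    proof
      fix k assume "k \<in> cone hull E"
      then obtain c v s where k: "k = c *\<^sub>R (v, s)" "c \<ge> 0" "(v, s) \<in> E"
        by (auto simp: cone_hull_expl)
      have "c * - (L * norm v) \<le> c * s" using low[OF k(3)] k(2) by (rule mult_left_mono)
      then show "k \<in> {k. - (L * norm (fst k)) \<le> snd k}" using k by (simp add: algebra_simps)
    qed
  qed
  then have x0: "(0, -1) \<notin> K" by auto
  obtain p where p: "p \<in> K" "\<And>c. c \<in> K \<Longrightarrow> ((0, -1) - p) \<bullet> (c - p) \<le> 0"
    using projection_exists[OF K(1-3), of "(0, -1)"] by metis
  define a where "a = p - (0, -1)"
  \<comment> \<open>Moving along the ray through \<open>p\<close>, which stays in the cone, in both directions gives orthogonality.\<close>
  have "2 *\<^sub>R p \<in> K" "0 *\<^sub>R p \<in> K" by (rule mem_cone[OF K(4) p(1)]; simp)+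
  with p(2)[of "2 *\<^sub>R p"] p(2)[of "0 *\<^sub>R p"] have ap: "((0, -1) - p) \<bullet> p = 0"
    by (simp add: scaleR_2)
  have ge: "0 \<le> a \<bullet> c" if "c \<in> K" for c
    using p(2)[OF that] ap by (simp add: a_def inner_diff_right inner_diff_left)
  have "a \<noteq> 0" using p(1) x0 by (auto simp: a_def)
  then have "0 < a \<bullet> a" by simp
  also have "a \<bullet> a = snd a"
  proof -
    have "a \<bullet> p = 0" using ap by (simp add: a_def inner_diff_left)
    moreover have "a \<bullet> a = a \<bullet> p - a \<bullet> (0, -1)" by (metis a_def inner_diff_right)
    ultimately show ?thesis by (simp add: inner_prod_def)
  qed
  finally have b: "snd a > 0" .
  show thesis
  proof (rule that[of "- (fst a /\<^sub>R snd a)"])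
    fix v s assume "(v, s) \<in> E"
    then have "(v, s) \<in> K" unfolding K_def by (meson closure_subset hull_subset subsetD)
    from ge[OF this] have "- (fst a \<bullet> v) \<le> snd a * s" by (simp add: inner_prod_def)
    then have "- (fst a \<bullet> v) / snd a \<le> s" using b by (subst pos_divide_le_eq) (auto simp: mult.commute)
    then show "- (fst a /\<^sub>R snd a) \<bullet> v \<le> s" by (simp add: divide_inverse mult.commute)
  qed
qed

lemma closure_span_scaleR: "v \<in> closure (span C) \<Longrightarrow> c *\<^sub>R v \<in> closure (span C)"
  for v :: "'w::real_normed_vector"
  using image_closure_subset[of "span C" "\<lambda>v. c *\<^sub>R v" "closure (span C)"]
  by (force intro: continuous_intros span_scale closure_subset[THEN subsetD])

lemma closure_span_add:
  fixes u v :: "'w::real_normed_vector"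
  assumes "u \<in> closure (span C)" "v \<in> closure (span C)"
  shows "u + v \<in> closure (span C)"
proof -
  have "convex (closure (span C))" by (intro convex_closure subspace_imp_convex subspace_span)
  from convexD[OF this assms, of "1/2" "1/2"]
  have "(1/2) *\<^sub>R u + (1/2) *\<^sub>R v \<in> closure (span C)" by simp
  from closure_span_scaleR[OF this, of 2] show ?thesis by (simp add: scaleR_add_right)
qed

text \<open>
  Sets on which the value function \<open>v \<mapsto> inf\<^sub>x \<Sum>\<^sub>i f\<^sub>i (x - v\<^sub>i)\<close> is bounded above. The
  bound on the norm of \<open>x\<close> provides the weak compactness that makes them closed, and bounding the terms
  separately rather than their sum makes membership a condition on sublevel sets.
\<close>

definition perturbation_set :: "('m \<Rightarrow> 'a::real_normed_vector \<Rightarrow> ereal) \<Rightarrow> real \<Rightarrow> ('a ^ 'm) set" where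
  "perturbation_set f k = {v. \<exists>x. norm x \<le> k \<and> (\<forall>i. f i (x - v $ i) \<le> ereal k)}"

lemma perturbation_set_mono: "k \<le> k' \<Longrightarrow> perturbation_set f k \<subseteq> perturbation_set f k'"
  unfolding perturbation_set_def by (auto intro: order_trans) (meson ereal_less_eq(3) order_trans)

lemma perturbation_set_convex:
  assumes f: "\<And>i. f i \<in> Gamma0"
  shows "convex (perturbation_set f k)"
proof (rule convexI)
  fix v w and s t :: real
  assume *: "v \<in> perturbation_set f k" "w \<in> perturbation_set f k" "0 \<le> s" "0 \<le> t" "s + t = 1"
  obtain x where x: "norm x \<le> k" "\<And>i. f i (x - v $ i) \<le> ereal k"
    using *(1) by (auto simp: perturbation_set_def)
  obtain z where z: "norm z \<le> k" "\<And>i. f i (z - w $ i) \<le> ereal k"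
    using *(2) by (auto simp: perturbation_set_def)
  have "s *\<^sub>R x + t *\<^sub>R z \<in> cball 0 k" using x z * by (intro convexD[OF convex_cball]) auto
  moreover have "f i (s *\<^sub>R x + t *\<^sub>R z - (s *\<^sub>R v + t *\<^sub>R w) $ i) \<le> ereal k" for i
  proof -
    have "s *\<^sub>R (x - v $ i) + t *\<^sub>R (z - w $ i) \<in> {y. f i y \<le> ereal k}"
      using x z * by (intro convexD[OF Gamma0_sublevel_convex[OF f]]) auto
    then show ?thesis by (simp add: algebra_simps)
  qed
  ultimately show "s *\<^sub>R v + t *\<^sub>R w \<in> perturbation_set f k" by (auto simp: perturbation_set_def)
qed

text \<open>
  Witnesses \<open>x\<close> for a convergent sequence of perturbations are bounded, so they have a weak cluster
  point, and balls and sublevel sets are closed under weak limits.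
\<close>

lemma perturbation_set_closed:
  fixes f :: "'m::finite \<Rightarrow> 'a::{real_inner, complete_space} \<Rightarrow> ereal"
  assumes f: "\<And>i. f i \<in> Gamma0"
  shows "closed (perturbation_set f k)"
  unfolding closed_sequential_limits
proof (intro allI impI, elim conjE)
  fix v w assume v: "\<forall>n. v n \<in> perturbation_set f k" "v \<longlonglongrightarrow> w"
  then obtain x where x: "\<And>n. norm (x n) \<le> k" "\<And>n i. f i (x n - v n $ i) \<le> ereal k"
    unfolding perturbation_set_def by simp metis
  obtain F z where F: "F \<le> sequentially" "F \<noteq> bot" "\<And>u. ((\<lambda>n. x n \<bullet> u) \<longlongrightarrow> z \<bullet> u) F"
    using weak_cluster_point[of sequentially x k] x(1) by auto
  have "z \<in> cball 0 k"
    by (rule weak_limit_in_closed_convex[OF _ _ F(2) _ F(3)]) (auto simp: x)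
  moreover have "z - w $ i \<in> {y. f i y \<le> ereal k}" for i
  proof (rule weak_limit_in_closed_convex[OF Gamma0_sublevel_closed[OF f] Gamma0_sublevel_convex[OF f] F(2)])
    show "\<forall>\<^sub>F n in F. x n - v n $ i \<in> {y. f i y \<le> ereal k}" using x by simp
    fix u
    have "((\<lambda>n. v n $ i) \<longlongrightarrow> w $ i) F"
      using tendsto_vec_nth[OF v(2)] F(1) by (meson filterlim_mono order_refl)
    from tendsto_diff[OF F(3) tendsto_inner[OF this tendsto_const]] show "((\<lambda>n. (x n - v n $ i) \<bullet> u) \<longlongrightarrow> (z - w $ i) \<bullet> u) F"
      by (simp add: inner_diff_left)
  qed
  ultimately show "w \<in> perturbation_set f k" by (auto simp: perturbation_set_def)
qed

lemma qualification_common_point: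
  fixes f :: "'m::finite \<Rightarrow> 'a::real_normed_vector \<Rightarrow> ereal"
  assumes "(0 :: 'a ^ 'm) \<in> {(\<chi> i. z - u i) | z u. \<forall>i. u i \<in> edom (f i)}"
  obtains z where "\<And>i. z \<in> edom (f i)"
proof -
  obtain z u where zu: "0 = (\<chi> i. z - u i)" "\<And>i. u i \<in> edom (f i)"
    using assms by blast
  have "u i = z" for i using zu(1) by (simp add: vec_eq_iff)
  with zu(2) that show thesis by metis
qed

text \<open>
  The closed subspace \<open>V\<close> generated by \<open>C\<close> is the cone of \<open>C\<close>, so every vector of \<open>V\<close> has a multiple
  in some perturbation set. Thus \<open>V\<close> is a countable union of closed sets, and by Baire's theorem one of
  them contains a relative ball around some \<open>v\<^sub>0\<close>. Averaging with a multiple of \<open>- v\<^sub>0\<close>, which also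
  lies in a perturbation set, moves the ball to the origin.
\<close>

lemma perturbation_set_neighbourhood:
  fixes f :: "'m::finite \<Rightarrow> 'a::{real_inner, complete_space} \<Rightarrow> ereal"
  defines "C \<equiv> {(\<chi> i. z - u i) | z u. \<forall>i. u i \<in> edom (f i)}"
  assumes f: "\<And>i. f i \<in> Gamma0" and q: "(0 :: 'a ^ 'm) \<in> sri C"
  obtains \<rho> K where "\<rho> > 0" "\<And>v. v \<in> closure (span C) \<Longrightarrow> norm v \<le> \<rho> \<Longrightarrow> v \<in> perturbation_set f K"
proof -
  define V where "V = closure (span C)"
  have "(\<lambda>z. z - 0) ` C = C" by simp
  then have C0: "0 \<in> C" and cone: "cone_of C = V"
    using q by (auto simp: sri_def V_def)
  have real_val: "\<exists>r. f i y \<le> ereal r" if "y \<in> edom (f i)" for i y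
    using that by (cases "f i y") (auto simp: edom_def)
  obtain z' where z': "\<And>i. z' \<in> edom (f i)"
    using qualification_common_point[OF C0[unfolded C_def]] by blast
  obtain B where B: "\<And>i. f i z' \<le> ereal (B i)" using real_val[OF z'] by metis
  have absorb: "\<exists>n. (1 / real (Suc n)) *\<^sub>R v \<in> perturbation_set f (real (Suc n))" if "v \<in> V" for v
  proof -
    have "v \<in> cone_of C" using that cone by simp
    then obtain c z u where c: "c > 0" "v = c *\<^sub>R (\<chi> i. z - u i)" "\<And>i. u i \<in> edom (f i)"
      by (auto simp: cone_of_def C_def)
    obtain A where A: "\<And>i. f i (u i) \<le> ereal (A i)" using real_val[OF c(3)] by metis
    \<comment> \<open>A bound on all data of the representation of \<open>v\<close>; beyond it, \<open>v\<close> scaled by \<open>1 / N\<close> is a convex combination of a point of \<open>C\<close> and the origin.\<close>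
    define M where "M = c + norm z + norm z' + (\<Sum>i\<in>UNIV. \<bar>A i\<bar>) + (\<Sum>i\<in>UNIV. \<bar>B i\<bar>)"
    obtain n where n: "M \<le> real n" using real_arch_simple by blast
    define N where "N = real (Suc n)"
    have N: "M \<le> N" "N > 0" using n by (auto simp: N_def)
    have S: "0 \<le> (\<Sum>i\<in>UNIV. \<bar>A i\<bar>)" "0 \<le> (\<Sum>i\<in>UNIV. \<bar>B i\<bar>)" by (auto intro: sum_nonneg)
    have AB: "A i \<le> N" "B i \<le> N" for i
    proof -
      have "\<bar>A i\<bar> \<le> (\<Sum>i\<in>UNIV. \<bar>A i\<bar>)" "\<bar>B i\<bar> \<le> (\<Sum>i\<in>UNIV. \<bar>B i\<bar>)"
        by (rule member_le_sum; simp)+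
      moreover have "0 \<le> norm z" "0 \<le> norm z'" by auto
      ultimately show "A i \<le> N" "B i \<le> N" using N S c(1) unfolding M_def by linarith+
    qed
    have nz: "norm z \<le> N" "norm z' \<le> N" "c \<le> N"
      using N S c(1) norm_ge_zero[of z] norm_ge_zero[of z'] unfolding M_def by linarith+
    define t where "t = c / N"
    have t: "0 \<le> t" "t \<le> 1" using c(1) nz N by (auto simp: t_def)
    define x where "x = t *\<^sub>R z + (1 - t) *\<^sub>R z'"
    have "x \<in> cball 0 N" unfolding x_def using t nz by (intro convexD[OF convex_cball]) auto
    moreover have "f i (x - ((1 / N) *\<^sub>R v) $ i) \<le> ereal N" for i
    proof -
      have "x - ((1 / N) *\<^sub>R v) $ i = t *\<^sub>R u i + (1 - t) *\<^sub>R z'"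
        by (simp add: x_def c(2) t_def algebra_simps)
      moreover have "t *\<^sub>R u i + (1 - t) *\<^sub>R z' \<in> {y. f i y \<le> ereal N}"
        using t AB[of i] order_trans[OF A[of i]] order_trans[OF B[of i]]
        by (intro convexD[OF Gamma0_sublevel_convex[OF f]]) auto
      ultimately show ?thesis by simp
    qed
    ultimately have "(1 / N) *\<^sub>R v \<in> perturbation_set f N" by (auto simp: perturbation_set_def)
    then show ?thesis unfolding N_def by blast
  qed
  define T where "T n = V \<inter> (\<lambda>v. (1 / real (Suc n)) *\<^sub>R v) -` perturbation_set f (real (Suc n))" for n
  have "closed V" by (simp add: V_def)
  have T: "closedin (top_of_set V) (T n)" for n
    unfolding T_def
    by (rule continuous_closedin_preimage) (auto intro!: continuous_intros perturbation_set_closed f)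
  have V0: "0 \<in> V" unfolding V_def by (meson closure_subset span_zero subsetD)
  have "\<Union> (range T) = V" using absorb by (auto simp: T_def)
  then have "top_of_set V interior_of \<Union> (range T) \<noteq> {}"
    using V0 interior_of_topspace[of "top_of_set V"] by auto
  moreover have "completely_metrizable_space (top_of_set V)"
    using \<open>closed V\<close> closed_closedin completely_metrizable_space_closedin completely_metrizable_space_euclidean
    by blast
  ultimately obtain n where "top_of_set V interior_of T n \<noteq> {}"
    using Baire_category_alt[of "top_of_set V" "range T"] T by auto
  then obtain v0 where v0: "v0 \<in> top_of_set V interior_of T n" by auto
  moreover have "openin (top_of_set V) (top_of_set V interior_of T n)" by simp
  ultimately obtain \<epsilon> where \<epsilon>: "\<epsilon> > 0" "ball v0 \<epsilon> \<inter> V \<subseteq> top_of_set V interior_of T n"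
    using openin_contains_ball[of V "top_of_set V interior_of T n"] by metis
  have ball: "ball v0 \<epsilon> \<inter> V \<subseteq> T n"
    using \<epsilon>(2) interior_of_subset[of "top_of_set V" "T n"] by (rule subset_trans)
  have v0V: "v0 \<in> V" using v0 interior_of_subset[of "top_of_set V" "T n"] by (auto simp: T_def)
  then have "- v0 \<in> V" using closure_span_scaleR[of v0 C "-1"] by (simp add: V_def)
  then obtain n' where n': "(1 / real (Suc n')) *\<^sub>R - v0 \<in> perturbation_set f (real (Suc n'))"
    using absorb by blast
  define N where "N = real (Suc n)"
  define N' where "N' = real (Suc n')"
  have N: "N > 0" "N' > 0" by (auto simp: N_def N'_def)
  show thesis
  proof (rule that[of "\<epsilon> / (2 * (N + N'))" "max N N'"])
    show "\<epsilon> / (2 * (N + N')) > 0" using \<epsilon> N by simp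
    fix v assume v: "v \<in> closure (span C)" "norm v \<le> \<epsilon> / (2 * (N + N'))"
    define u where "u = (N + N') *\<^sub>R v"
    have "norm u = (N + N') * norm v" using N by (simp add: u_def)
    then have "norm u \<le> \<epsilon> / 2" using v(2) N by (simp add: field_simps)
    then have "v0 + u \<in> ball v0 \<epsilon>" using \<epsilon>(1) by (simp add: dist_norm)
    moreover have "v0 + u \<in> V" unfolding V_def u_def
      using v0V v(1) closure_span_add closure_span_scaleR V_def by blast
    ultimately have "v0 + u \<in> T n" using ball by blast
    then have 1: "(1 / N) *\<^sub>R (v0 + u) \<in> perturbation_set f (max N N')"
      using perturbation_set_mono[of N "max N N'" f] by (auto simp: T_def N_def)
    have 2: "(1 / N') *\<^sub>R - v0 \<in> perturbation_set f (max N N')"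
      using n' perturbation_set_mono[of N' "max N N'" f] by (auto simp: N'_def)
    have "N / (N + N') + N' / (N + N') = 1" using N by (simp add: add_divide_distrib[symmetric])
    then have "(N / (N + N')) *\<^sub>R (1 / N) *\<^sub>R (v0 + u) + (N' / (N + N')) *\<^sub>R (1 / N') *\<^sub>R - v0
        \<in> perturbation_set f (max N N')"
      using N by (intro convexD[OF perturbation_set_convex[OF f] 1 2]) auto
    moreover have "(N / (N + N')) *\<^sub>R (1 / N) *\<^sub>R (v0 + u) + (N' / (N + N')) *\<^sub>R (1 / N') *\<^sub>R - v0 = v"
      using N by (simp add: u_def scaleR_add_right)
    ultimately show "v \<in> perturbation_set f (max N N')" by simp
  qed
qed

text \<open>
  The set \<open>E\<close> is the epigraph of the value function of the perturbed problems, shifted to vanish at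
  the origin. Its upper bound \<open>D\<close> on a ball of radius \<open>\<rho>\<close> turns by convexity into the global lower bound
  \<open>- (\<bar>D\<bar> / \<rho>) \<parallel>v\<parallel>\<close>: the origin is a convex combination of \<open>v\<close> and of the vector of norm \<open>\<rho>\<close>
  opposite to it, and the value at the origin is 0. The linear minorant \<open>w\<close> from
  \<open>sandwich_affine\<close> splits into the required subgradients: perturbations along the diagonal show
  that its components sum to zero, and perturbations of a single component give the subgradient
  inequality of the corresponding function.
\<close>

lemma sum_subgradients_at_minimizer:
  fixes f :: "'m::finite \<Rightarrow> 'a::{real_inner, complete_space} \<Rightarrow> ereal"
  assumes f: "\<And>i. f i \<in> Gamma0"
    and q: "(0 :: 'a ^ 'm) \<in> sri {(\<chi> i. z - u i) | z u. \<forall>i. u i \<in> edom (f i)}" (is "_ \<in> sri ?C")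
    and min: "z0 \<in> minimizers (\<lambda>z. \<Sum>i\<in>UNIV. f i z)"
  obtains u where "\<And>i. subgradient (f i) z0 (u i)" "(\<Sum>i\<in>UNIV. u i) = 0"
proof -
  have le: "(\<Sum>i\<in>UNIV. f i z0) \<le> (\<Sum>i\<in>UNIV. f i z)" for z
    using min by (auto simp: minimizers_def is_arg_min_def not_less)
  have "0 \<in> ?C" using q by (simp add: sri_def)
  then obtain z' where "\<And>i. z' \<in> edom (f i)" using qualification_common_point by blast
  then have "(\<Sum>i\<in>UNIV. f i z') < \<infinity>"
    by (auto simp: edom_def less_top[symmetric] sum_Pinfty top_ereal_def)
  then have "(\<Sum>i\<in>UNIV. f i z0) \<noteq> \<infinity>" using le[of z'] by auto
  then have fin: "f i z0 \<noteq> \<infinity>" for i by (auto simp: sum_Pinfty)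
  define h where "h i = real_of_ereal (f i z0)" for i
  have h: "f i z0 = ereal (h i)" for i
    using fin[of i] Gamma0_not_minfty[OF f, of i z0] by (cases "f i z0") (auto simp: h_def)
  define h0 where "h0 = (\<Sum>i\<in>UNIV. h i)"
  have h0_le: "h0 \<le> (\<Sum>i\<in>UNIV. r i)" if "\<And>i. f i x \<le> ereal (r i)" for x r
  proof -
    have "ereal h0 \<le> (\<Sum>i\<in>UNIV. f i x)" using le[of x] by (simp add: h h0_def)
    also have "\<dots> \<le> (\<Sum>i\<in>UNIV. ereal (r i))" by (intro sum_mono that)
    finally show ?thesis by simp
  qed
  define E where "E = {(v :: 'a ^ 'm, s). \<exists>x r. (\<forall>i. f i (x - v $ i) \<le> ereal (r i)) \<and> (\<Sum>i\<in>UNIV. r i) \<le> h0 + s}"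
  have E_I: "(v, s) \<in> E" if "\<And>i. f i (x - v $ i) \<le> ereal (r i)" "(\<Sum>i\<in>UNIV. r i) \<le> h0 + s" for v s x r
    using that by (auto simp: E_def)
  have E_convex: "convex E"
  proof (rule convexI, clarify)
    fix v1 v2 :: "'a ^ 'm" and s1 s2 t1 t2 :: real
    assume *: "(v1, s1) \<in> E" "(v2, s2) \<in> E" "0 \<le> t1" "0 \<le> t2" "t1 + t2 = 1"
    obtain x1 r1 where 1: "\<And>i. f i (x1 - v1 $ i) \<le> ereal (r1 i)" "(\<Sum>i\<in>UNIV. r1 i) \<le> h0 + s1"
      using *(1) by (auto simp: E_def)
    obtain x2 r2 where 2: "\<And>i. f i (x2 - v2 $ i) \<le> ereal (r2 i)" "(\<Sum>i\<in>UNIV. r2 i) \<le> h0 + s2"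
      using *(2) by (auto simp: E_def)
    have t: "t2 = 1 - t1" "t1 \<le> 1" using * by auto
    have "f i ((t1 *\<^sub>R x1 + t2 *\<^sub>R x2) - (t1 *\<^sub>R v1 + t2 *\<^sub>R v2) $ i) \<le> ereal (t1 * r1 i + t2 * r2 i)" for i
      using Gamma0_convexD[OF f 1(1)[of i] 2(1)[of i] *(3) t(2)] by (simp add: t algebra_simps)
    moreover have "(\<Sum>i\<in>UNIV. t1 * r1 i + t2 * r2 i) \<le> h0 + (t1 * s1 + t2 * s2)"
    proof -
      have "(\<Sum>i\<in>UNIV. t1 * r1 i + t2 * r2 i) = t1 * (\<Sum>i\<in>UNIV. r1 i) + t2 * (\<Sum>i\<in>UNIV. r2 i)"
        by (simp add: sum.distrib sum_distrib_left)
      also have "\<dots> \<le> t1 * (h0 + s1) + t2 * (h0 + s2)" using * 1 2 by (intro add_mono mult_left_mono)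
      also have "\<dots> = h0 + (t1 * s1 + t2 * s2)" by (simp add: t algebra_simps)
      finally show ?thesis .
    qed
    ultimately have "(t1 *\<^sub>R v1 + t2 *\<^sub>R v2, t1 * s1 + t2 * s2) \<in> E" by (rule E_I)
    then show "t1 *\<^sub>R (v1, s1) + t2 *\<^sub>R (v2, s2) \<in> E" by simp
  qed
  have "(0, 0) \<in> E" by (rule E_I[of z0 _ h]) (auto simp: h h0_def)
  then have E_ne: "E \<noteq> {}" by auto
  obtain \<rho> K where \<rho>: "\<rho> > 0"
    "\<And>v. v \<in> closure (span ?C) \<Longrightarrow> norm v \<le> \<rho> \<Longrightarrow> v \<in> perturbation_set f K"
    by (rule perturbation_set_neighbourhood[OF f q]) (rule that)
  define D where "D = real CARD('m) * K - h0"
  have E_low: "- (\<bar>D\<bar> / \<rho> * norm v) \<le> s" if vs: "(v, s) \<in> E" for v s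
  proof (cases "v = 0")
    case True
    then obtain x r where "\<And>i. f i x \<le> ereal (r i)" "(\<Sum>i\<in>UNIV. r i) \<le> h0 + s"
      using vs by (auto simp: E_def)
    with h0_le[of x r] True show ?thesis by simp
  next
    case False
    obtain x r where r: "\<And>i. f i (x - v $ i) \<le> ereal (r i)" "(\<Sum>i\<in>UNIV. r i) \<le> h0 + s"
      using vs by (auto simp: E_def)
    define \<delta> where "\<delta> = norm v / \<rho>"
    have \<delta>: "\<delta> > 0" using False \<rho>(1) by (simp add: \<delta>_def)
    have "x - v $ i \<in> edom (f i)" for i using r(1)[of i] by (auto simp: edom_def)
    then have "v \<in> ?C" by (intro CollectI exI[of _ x] exI[of _ "\<lambda>i. x - v $ i"]) (simp add: vec_eq_iff)
    then have "v \<in> closure (span ?C)" by (meson closure_subset span_base subsetD)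
    then have "(- (1 / \<delta>)) *\<^sub>R v \<in> closure (span ?C)" by (rule closure_span_scaleR)
    moreover have "norm ((- (1 / \<delta>)) *\<^sub>R v) \<le> \<rho>" using False \<rho>(1) by (simp add: \<delta>_def)
    ultimately have "(- (1 / \<delta>)) *\<^sub>R v \<in> perturbation_set f K" by (rule \<rho>(2))
    then obtain x' where x': "\<And>i. f i (x' - ((- (1 / \<delta>)) *\<^sub>R v) $ i) \<le> ereal K"
      unfolding perturbation_set_def by blast
    \<comment> \<open>The weight with which \<open>v\<close> and its opposite of norm \<open>\<rho>\<close> average to the origin.\<close>
    define t where "t = 1 / (1 + \<delta>)"
    have t: "0 \<le> t" "t \<le> 1" "1 - t = \<delta> * t" using \<delta> by (auto simp: t_def field_simps)
    have "f i (t *\<^sub>R x + (1 - t) *\<^sub>R x') \<le> ereal (t * r i + (1 - t) * K)" for i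
    proof -
      have "(1 - t) * (1 / \<delta>) = t" using t(3) \<delta> by simp
      then have "(1 - t) *\<^sub>R ((1 / \<delta>) *\<^sub>R (v $ i)) = t *\<^sub>R (v $ i)" by (simp only: scaleR_scaleR)
      then have "t *\<^sub>R (x - v $ i) + (1 - t) *\<^sub>R (x' - ((- (1 / \<delta>)) *\<^sub>R v) $ i) = t *\<^sub>R x + (1 - t) *\<^sub>R x'"
        by (simp add: scaleR_diff_right scaleR_add_right)
      then show ?thesis using Gamma0_convexD[OF f r(1)[of i] x'[of i] t(1,2)] by simp
    qed
    then have "h0 \<le> (\<Sum>i\<in>UNIV. t * r i + (1 - t) * K)" by (rule h0_le)
    also have "\<dots> = t * (\<Sum>i\<in>UNIV. r i) + (1 - t) * (real CARD('m) * K)"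
      by (simp add: sum.distrib sum_distrib_left)
    also have "\<dots> \<le> t * (h0 + s) + \<delta> * t * (real CARD('m) * K)"
      using r(2) t by (simp add: mult_left_mono)
    finally have "(1 + \<delta>) * h0 \<le> (1 + \<delta>) * (t * (h0 + s) + \<delta> * t * (real CARD('m) * K))"
      using \<delta> by (intro mult_left_mono) auto
    also have "\<dots> = ((1 + \<delta>) * t) * (h0 + s + \<delta> * (real CARD('m) * K))" by (simp add: algebra_simps)
    also have "(1 + \<delta>) * t = 1" using \<delta> by (simp add: t_def)
    finally have "- (\<delta> * D) \<le> s" by (simp add: D_def algebra_simps)
    moreover have "\<delta> * D \<le> \<delta> * \<bar>D\<bar>" using \<delta> by (intro mult_left_mono) auto
    ultimately show ?thesis by (simp add: \<delta>_def mult.commute)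
  qed
  obtain w where w: "\<And>v s. (v, s) \<in> E \<Longrightarrow> w \<bullet> v \<le> s"
    by (rule sandwich_affine[OF E_convex E_ne E_low]) (assumption, rule that)
  have "(\<Sum>i\<in>UNIV. w $ i) = 0"
  proof -
    let ?d = "\<Sum>i\<in>UNIV. w $ i"
    have "((\<chi> i. ?d), 0) \<in> E"
      by (rule E_I[of "z0 + ?d" _ h]) (auto simp: h h0_def)
    from w[OF this] have "?d \<bullet> ?d \<le> 0" by (simp add: inner_vec_def inner_sum_left)
    then show ?thesis using inner_gt_zero_iff[of ?d] by fastforce
  qed
  moreover have "subgradient (f i) z0 (- (w $ i))" for i
    unfolding subgradient_def
  proof
    fix y
    show "f i z0 + ereal (- (w $ i) \<bullet> (y - z0)) \<le> f i y"
    proof (cases "f i y")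
      case (real b)
      have "(axis i (z0 - y), b - h i) \<in> E"
      proof (rule E_I[of z0 _ "h(i := b)"])
        show "f j (z0 - axis i (z0 - y) $ j) \<le> ereal ((h(i := b)) j)" for j
          by (cases "j = i") (auto simp: axis_def real h)
        have "(\<Sum>j\<in>UNIV. (h(i := b)) j) = b + (\<Sum>j\<in>UNIV - {i}. h j)"
          by (subst sum.remove[of _ i]) auto
        also have "(\<Sum>j\<in>UNIV - {i}. h j) = h0 - h i" by (simp add: h0_def sum_diff1)
        finally show "(\<Sum>j\<in>UNIV. (h(i := b)) j) \<le> h0 + (b - h i)" by simp
      qed
      from w[OF this] have "w $ i \<bullet> (z0 - y) \<le> b - h i" by (simp add: inner_axis)
      then show ?thesis by (simp add: real h inner_diff_right)
    qed (use Gamma0_not_minfty[OF f, of i y] in auto)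
  qed
  ultimately show thesis using that[of "\<lambda>i. - (w $ i)"] by (simp add: sum_negf)
qed

section \<open>Parallel splitting\<close>

text \<open>
  If \<open>p\<close> and \<open>q\<close> are the resolvents of a monotone operator at \<open>u\<close> and \<open>v\<close>, the hypothesis is
  monotonicity, and the conclusion says that twice the resolvent minus the identity is nonexpansive.
\<close>

lemma reflected_resolvent_nonexpansive:
  fixes u v p q :: "'a::real_inner"
  assumes "0 \<le> ((u - p) - (v - q)) \<bullet> (p - q)"
  shows "norm ((2 *\<^sub>R p - u) - (2 *\<^sub>R q - v)) \<le> norm (u - v)"
proof (rule power2_le_imp_le)
  have "(norm (2 *\<^sub>R b - a))\<^sup>2 = (norm a)\<^sup>2 - 4 * ((a - b) \<bullet> b)" for a b :: 'a
    unfolding power2_norm_eq_inner by (simp add: inner_diff_left inner_diff_right inner_commute algebra_simps)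
  from this[of "p - q" "u - v"]
  have "(norm ((2 *\<^sub>R p - u) - (2 *\<^sub>R q - v)))\<^sup>2
      = (norm (u - v))\<^sup>2 - 4 * (((u - p) - (v - q)) \<bullet> (p - q))"
    by (simp add: scaleR_diff_right diff_diff_eq2 algebra_simps)
  then show "(norm ((2 *\<^sub>R p - u) - (2 *\<^sub>R q - v)))\<^sup>2 \<le> (norm (u - v))\<^sup>2"
    using assms by linarith
qed simp

text \<open>
  The weighted mean is the orthogonal projector onto the diagonal for the weighted inner product, so
  the corresponding reflection preserves the norm.
\<close>

lemma weighted_mean_reflection_isometric:
  fixes d :: "'m::finite \<Rightarrow> 'a::real_inner"
  assumes "(\<Sum>i\<in>UNIV. \<omega> i) = 1"
  shows "(\<Sum>i\<in>UNIV. \<omega> i * (norm (2 *\<^sub>R (\<Sum>j\<in>UNIV. \<omega> j *\<^sub>R d j) - d i))\<^sup>2)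
    = (\<Sum>i\<in>UNIV. \<omega> i * (norm (d i))\<^sup>2)"
proof -
  define P where "P = (\<Sum>j\<in>UNIV. \<omega> j *\<^sub>R d j)"
  have "\<omega> i * (norm (2 *\<^sub>R P - d i))\<^sup>2
      = 4 * (P \<bullet> P) * \<omega> i - 4 * (P \<bullet> (\<omega> i *\<^sub>R d i)) + \<omega> i * (norm (d i))\<^sup>2" for i
    unfolding power2_norm_eq_inner by (simp add: inner_diff_left inner_diff_right inner_commute algebra_simps)
  then have "(\<Sum>i\<in>UNIV. \<omega> i * (norm (2 *\<^sub>R P - d i))\<^sup>2)
      = 4 * (P \<bullet> P) * (\<Sum>i\<in>UNIV. \<omega> i) - 4 * (P \<bullet> (\<Sum>i\<in>UNIV. \<omega> i *\<^sub>R d i))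
        + (\<Sum>i\<in>UNIV. \<omega> i * (norm (d i))\<^sup>2)"
    by (simp only: sum.distrib sum_subtractf sum_distrib_left inner_sum_right)
  then show ?thesis by (simp add: assms P_def)
qed

lemma norm_vec_sq: "(norm v)\<^sup>2 = (\<Sum>i\<in>UNIV. (norm (v $ i))\<^sup>2)" for v :: "'a::real_inner ^ 'm::finite"
  by (simp add: power2_norm_eq_inner inner_vec_def)

text \<open>
  The type of vectors carries only the unweighted inner product. The coordinates
  \<open>Z $ i = sqrt (\<omega> i) * y i\<close> turn it into the weighted one, so that \<open>krasnoselskii_mann\<close>
  applies to \<open>R\<close> in these coordinates; \<open>Y\<close> translates back.
\<close>

theorem theorem3p4:
  fixes f :: "'m::finite \<Rightarrow> 'a::{real_inner, complete_space} \<Rightarrow> ereal"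
    and G :: "'a set"
    and \<gamma> :: real
    and \<omega> :: "'m \<Rightarrow> real"
    and l :: "nat \<Rightarrow> real"
    and a p y :: "'m \<Rightarrow> nat \<Rightarrow> 'a"
    and pbar x :: "nat \<Rightarrow> 'a"
  assumes f: "\<And>i. f i \<in> Gamma0"
    and G: "G = minimizers (\<lambda>z. \<Sum>i\<in>UNIV. f i z)"
    and \<gamma>: "\<gamma> > 0"
    and \<omega>: "\<And>i. \<omega> i \<in> {0<..1}"
    and \<omega>_sum: "(\<Sum>i\<in>UNIV. \<omega> i) = 1"
    and l: "\<And>n. l n \<in> {0<..<2}"
    and x_0: "x 0 = (\<Sum>i\<in>UNIV. \<omega> i *\<^sub>R y i 0)"
    and p: "\<And>i n. p i n = prox (\<lambda>z. ereal (\<gamma> / \<omega> i) * f i z) (y i n) + a i n"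
    and pbar: "\<And>n. pbar n = (\<Sum>i\<in>UNIV. \<omega> i *\<^sub>R p i n)"
    and y: "\<And>i n. y i (Suc n) = y i n + l n *\<^sub>R (2 *\<^sub>R pbar n - x n - p i n)"
    and x: "\<And>n. x (Suc n) = x n + l n *\<^sub>R (pbar n - x n)"
    and coercive: "((\<lambda>z. \<Sum>i\<in>UNIV. f i z) \<longlongrightarrow> \<infinity>) at_infinity"
    and qualification:
      "(0 :: 'a ^ 'm) \<in> sri {(\<chi> i. z - u i) | z u. \<forall>i. u i \<in> edom (f i)}"
    and l_sum: "filterlim (\<lambda>N. \<Sum>n<N. l n * (2 - l n)) at_top sequentially"
    and a_sum: "\<And>i. summable (\<lambda>n. l n * norm (a i n))"
  shows "G \<noteq> {} \<and> (\<exists>z\<in>G. converges_weakly_to x z)"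
proof -
  have \<omega>_pos: "\<omega> i > 0" for i using \<omega>[of i] by simp
  have c_pos: "\<gamma> / \<omega> i > 0" for i using \<gamma> \<omega>_pos by simp
  have l_bounds: "0 < l n" "l n < 2" for n using l[of n] by auto
  define s where "s i = sqrt (\<omega> i)" for i
  have s_pos: "s i > 0" and s_sq: "(s i)\<^sup>2 = \<omega> i" for i
    using \<omega>_pos[of i] by (auto simp: s_def)
  have s_mult: "s i * s i = \<omega> i" for i using s_sq[of i] by (simp add: power2_eq_square)
  define J where "J i = prox (\<lambda>z. ereal (\<gamma> / \<omega> i) * f i z)" for i
  have cf: "(\<lambda>z. ereal (\<gamma> / \<omega> i) * f i z) \<in> Gamma0" for i
    using Gamma0_scale[OF f c_pos] .
  \<comment> \<open>The scaling of the subgradient by \<open>\<omega> i / \<gamma>\<close> undoes that of the function.\<close>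
  have J_eq: "J i v = q \<longleftrightarrow> subgradient (f i) q ((\<omega> i / \<gamma>) *\<^sub>R (v - q))" for i v q
  proof -
    have "J i v = q \<longleftrightarrow> subgradient (\<lambda>z. ereal (\<gamma> / \<omega> i) * f i z) q (v - q)"
      using prox_subgradient[OF cf, of i] unfolding J_def by metis
    also have "v - q = (\<gamma> / \<omega> i) *\<^sub>R ((\<omega> i / \<gamma>) *\<^sub>R (v - q))" using \<gamma> \<omega>_pos[of i] by simp
    finally show ?thesis using subgradient_scale[OF f c_pos] by metis
  qed
  define RJ where "RJ i v = 2 *\<^sub>R J i v - v" for i v
  have RJ_nonexp: "norm (RJ i u - RJ i v) \<le> norm (u - v)" for i u v
    unfolding RJ_def J_def
    by (rule reflected_resolvent_nonexpansive,
        rule subgradient_monotone[OF cf prox_subgradient(1)[OF cf] prox_subgradient(1)[OF cf]])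
  define Y where "Y Z i = (1 / s i) *\<^sub>R (Z $ i)" for Z :: "'a ^ 'm" and i
  define mean where "mean v = (\<Sum>i\<in>UNIV. \<omega> i *\<^sub>R v i)" for v :: "'m \<Rightarrow> 'a"
  define R where "R Z = (\<chi> i. s i *\<^sub>R (2 *\<^sub>R mean (\<lambda>j. RJ j (Y Z j)) - RJ i (Y Z i)))" for Z
  have R_nonexp: "norm (R Z - R W) \<le> norm (Z - W)" for Z W
  proof (rule power2_le_imp_le)
    define d where "d i = RJ i (Y Z i) - RJ i (Y W i)" for i
    have "(R Z - R W) $ i = s i *\<^sub>R (2 *\<^sub>R mean d - d i)" for i
      by (simp add: R_def d_def mean_def sum_subtractf algebra_simps)
    then have "(norm (R Z - R W))\<^sup>2 = (\<Sum>i\<in>UNIV. \<omega> i * (norm (2 *\<^sub>R mean d - d i))\<^sup>2)"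
      by (simp add: norm_vec_sq power_mult_distrib s_sq)
    also have "\<dots> = (\<Sum>i\<in>UNIV. \<omega> i * (norm (d i))\<^sup>2)"
      unfolding mean_def by (rule weighted_mean_reflection_isometric[OF \<omega>_sum])
    also have "\<dots> \<le> (\<Sum>i\<in>UNIV. (norm ((Z - W) $ i))\<^sup>2)"
    proof (rule sum_mono)
      fix i
      have "norm (d i) \<le> norm (Y Z i - Y W i)" unfolding d_def by (rule RJ_nonexp)
      also have "Y Z i - Y W i = (1 / s i) *\<^sub>R ((Z - W) $ i)" by (simp add: Y_def scaleR_diff_right)
      also have "norm \<dots> = norm ((Z - W) $ i) / s i" using s_pos[of i] by simp
      finally have "s i * norm (d i) \<le> norm ((Z - W) $ i)"
        using s_pos[of i] by (simp add: pos_le_divide_eq mult.commute)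
      then have "(s i * norm (d i))\<^sup>2 \<le> (norm ((Z - W) $ i))\<^sup>2"
        using s_pos[of i] by (intro power_mono) auto
      then show "\<omega> i * (norm (d i))\<^sup>2 \<le> (norm ((Z - W) $ i))\<^sup>2" by (simp add: power_mult_distrib s_sq)
    qed
    also have "\<dots> = (norm (Z - W))\<^sup>2" by (simp add: norm_vec_sq)
    finally show "(norm (R Z - R W))\<^sup>2 \<le> (norm (Z - W))\<^sup>2" .
  qed simp
  have mean_scale: "mean (\<lambda>i. 2 *\<^sub>R u i - v i) = 2 *\<^sub>R mean u - mean v" for u v
    by (simp add: mean_def scaleR_diff_right sum_subtractf scaleR_sum_right mult.commute)
  have mean_const: "mean (\<lambda>_. c) = c" for c
    unfolding mean_def by (simp add: \<omega>_sum flip: scaleR_sum_left)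
  \<comment> \<open>In these coordinates half of \<open>R Z - Z\<close> is the increment of the recursion at relaxation 1, which is why \<open>l n / 2\<close> appears below.\<close>
  have R_coord: "(R Z) $ i = s i *\<^sub>R (4 *\<^sub>R mean (\<lambda>j. J j (Y Z j)) - 2 *\<^sub>R mean (Y Z) - 2 *\<^sub>R J i (Y Z i) + Y Z i)" for Z i
    unfolding R_def RJ_def mean_scale by (simp add: algebra_simps)
  have Z_coord: "Z $ i = s i *\<^sub>R Y Z i" for Z i using s_pos[of i] by (simp add: Y_def)
  have fix_imp: "mean (Y Z) \<in> G" if "R Z = Z" for Z
  proof -
    let ?q = "mean (\<lambda>j. J j (Y Z j))"
    have J: "J i (Y Z i) = 2 *\<^sub>R ?q - mean (Y Z)" for i
    proof -
      have "s i *\<^sub>R (4 *\<^sub>R ?q - 2 *\<^sub>R mean (Y Z) - 2 *\<^sub>R J i (Y Z i) + Y Z i) = s i *\<^sub>R Y Z i"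
        using that R_coord[of Z i] Z_coord[of Z i] by simp
      then have "4 *\<^sub>R ?q - 2 *\<^sub>R mean (Y Z) - 2 *\<^sub>R J i (Y Z i) + Y Z i = Y Z i"
        using s_pos[of i] by simp
      then have "2 *\<^sub>R J i (Y Z i) = 2 *\<^sub>R (2 *\<^sub>R ?q - mean (Y Z))" by (simp add: algebra_simps)
      then show ?thesis by (metis scaleR_cancel_left zero_neq_numeral)
    qed
    have "(\<lambda>j. J j (Y Z j)) = (\<lambda>_. 2 *\<^sub>R ?q - mean (Y Z))" using J by (rule ext)
    then have "?q = mean (\<lambda>_. 2 *\<^sub>R ?q - mean (Y Z))" by (rule arg_cong)
    then have "?q = 2 *\<^sub>R ?q - mean (Y Z)" by (simp only: mean_const)
    then have q: "?q = mean (Y Z)" by (simp add: scaleR_2)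
    have "J i (Y Z i) = mean (Y Z)" for i using J[of i] unfolding q by (simp add: scaleR_2)
    then have sub: "subgradient (f i) (mean (Y Z)) ((\<omega> i / \<gamma>) *\<^sub>R (Y Z i - mean (Y Z)))" for i
      unfolding J_eq by simp
    have "(\<Sum>i\<in>UNIV. (\<omega> i / \<gamma>) *\<^sub>R (Y Z i - mean (Y Z)))
        = (1 / \<gamma>) *\<^sub>R (mean (Y Z) - mean (\<lambda>_. mean (Y Z)))"
      by (simp add: mean_def scaleR_sum_right scaleR_diff_right sum_subtractf)
    also have "\<dots> = 0" by (simp add: mean_const)
    finally show ?thesis
      unfolding G by (rule subgradients_sum_zero_minimizer[OF f sub])
  qed
  have "G \<noteq> {}"
  proof -
    have "0 \<in> {(\<chi> i. z - u i) | z u. \<forall>i. u i \<in> edom (f i)}" using qualification by (simp add: sri_def)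
    then obtain z where "\<And>i. z \<in> edom (f i)" using qualification_common_point by blast
    from Gamma0_sum[OF f this] coercive show ?thesis
      unfolding G by (rule Gamma0_coercive_minimizer_exists)
  qed
  moreover have "\<exists>z\<in>G. converges_weakly_to x z"
  proof -
    obtain z0 where "z0 \<in> G" using \<open>G \<noteq> {}\<close> by auto
    then obtain u where u: "\<And>i. subgradient (f i) z0 (u i)" "(\<Sum>i\<in>UNIV. u i) = 0"
      unfolding G by (rule sum_subgradients_at_minimizer[OF f qualification]) (rule that)
    \<comment> \<open>The fixed point of \<open>R\<close> built from subgradients with sum zero.\<close>
    define Q where "Q = (\<chi> i. s i *\<^sub>R (z0 + (\<gamma> / \<omega> i) *\<^sub>R u i))"
    have YQ: "Y Q i = z0 + (\<gamma> / \<omega> i) *\<^sub>R u i" for i using s_pos[of i] by (simp add: Y_def Q_def)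
    have JQ: "J i (Y Q i) = z0" for i
      unfolding J_eq YQ using u(1)[of i] \<gamma> \<omega>_pos[of i] by simp
    have "mean (Y Q) = z0 + \<gamma> *\<^sub>R (\<Sum>i\<in>UNIV. u i)"
    proof -
      have "\<omega> i *\<^sub>R Y Q i = \<omega> i *\<^sub>R z0 + \<gamma> *\<^sub>R u i" for i
        using \<omega>_pos[of i] by (simp add: YQ scaleR_add_right)
      then show ?thesis
        by (simp add: mean_def sum.distrib scaleR_sum_right \<omega>_sum flip: scaleR_sum_left)
    qed
    then have "mean (Y Q) = z0" by (simp add: u(2))
    moreover have "4 *\<^sub>R z0 - 2 *\<^sub>R z0 - 2 *\<^sub>R z0 = 0" by (simp flip: scaleR_diff_left)
    ultimately have "R Q $ i = Q $ i" for i
      unfolding R_coord[of Q i] Z_coord[of Q i] JQ by (simp add: mean_const)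
    then have fixQ: "R Q = Q" by (simp add: vec_eq_iff)
    define Z where "Z n = (\<chi> i. s i *\<^sub>R y i n)" for n
    have YZ: "Y (Z n) i = y i n" for n i using s_pos[of i] by (simp add: Y_def Z_def)
    have YZ': "Y (Z n) = (\<lambda>i. y i n)" for n by (simp add: YZ fun_eq_iff)
    have x_mean: "x n = mean (\<lambda>i. y i n)" for n
    proof (induction n)
      case 0
      show ?case by (simp add: x_0 mean_def)
    next
      case (Suc n)
      have affine: "mean (\<lambda>i. u i + r *\<^sub>R (c - v i)) = mean u + r *\<^sub>R (mean (\<lambda>_. c) - mean v)" for u v r c
        by (simp add: mean_def scaleR_add_right scaleR_diff_right sum.distrib sum_subtractf
            scaleR_sum_right mult.commute)
      have "mean (\<lambda>i. y i (Suc n)) = mean (\<lambda>i. y i n)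
          + l n *\<^sub>R (2 *\<^sub>R pbar n - x n - mean (\<lambda>i. p i n))"
        unfolding y affine mean_const ..
      also have "mean (\<lambda>i. p i n) = pbar n" by (simp add: pbar mean_def)
      finally show ?case by (simp add: x Suc[symmetric] scaleR_2)
    qed
    define e where "e n = (\<chi> i. s i *\<^sub>R l n *\<^sub>R (2 *\<^sub>R mean (\<lambda>j. a j n) - a i n))" for n
    have step: "Z (Suc n) = Z n + (l n / 2) *\<^sub>R (R (Z n) - Z n) + e n" for n
    proof -
      have pb: "pbar n = mean (\<lambda>j. J j (y j n)) + mean (\<lambda>j. a j n)"
        by (simp add: pbar p J_def mean_def scaleR_add_right sum.distrib)
      have "Z (Suc n) $ i = (Z n + (l n / 2) *\<^sub>R (R (Z n) - Z n) + e n) $ i" for i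
      proof -
        define m1 m2 where "m1 = mean (\<lambda>j. J j (y j n))" and "m2 = mean (\<lambda>j. a j n)"
        have pi: "p i n = J i (y i n) + a i n" by (simp add: p J_def)
        have "R (Z n) $ i - Z n $ i = s i *\<^sub>R 2 *\<^sub>R (2 *\<^sub>R m1 - x n - J i (y i n))"
          unfolding R_coord Z_coord[of "Z n"] YZ YZ' x_mean m1_def by (simp add: algebra_simps)
        then have "(l n / 2) *\<^sub>R (R (Z n) $ i - Z n $ i) = s i *\<^sub>R l n *\<^sub>R (2 *\<^sub>R m1 - x n - J i (y i n))"
          by simp
        then show ?thesis
          by (simp add: Z_def e_def y pb pi scaleR_add_right scaleR_diff_right
              flip: m1_def m2_def)
      qed
      then show ?thesis by (simp add: vec_eq_iff)
    qed
    have e_sum: "summable (\<lambda>n. norm (e n))"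
    proof (rule summable_comparison_test')
      show "summable (\<lambda>n. \<Sum>i\<in>UNIV. 2 * (\<Sum>j\<in>UNIV. l n * norm (a j n)) + l n * norm (a i n))"
        by (intro summable_sum summable_add summable_mult a_sum)
      fix n :: nat assume "0 \<le> n"
      have "norm (e n) \<le> (\<Sum>i\<in>UNIV. norm (e n $ i))" by (simp add: norm_vec_def L2_set_le_sum)
      also have "\<dots> \<le> (\<Sum>i\<in>UNIV. 2 * (\<Sum>j\<in>UNIV. l n * norm (a j n)) + l n * norm (a i n))"
      proof (rule sum_mono)
        fix i
        have "norm (mean (\<lambda>j. a j n)) \<le> (\<Sum>j\<in>UNIV. norm (a j n))"
          unfolding mean_def using \<omega> \<omega>_pos
          by (intro sum_norm_le) (simp add: mult_left_le_one_le less_imp_le)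
        then have "norm (2 *\<^sub>R mean (\<lambda>j. a j n) - a i n) \<le> 2 * (\<Sum>j\<in>UNIV. norm (a j n)) + norm (a i n)"
          using norm_triangle_ineq4[of "2 *\<^sub>R mean (\<lambda>j. a j n)" "a i n"] by simp
        then have *: "l n * norm (2 *\<^sub>R mean (\<lambda>j. a j n) - a i n)
            \<le> l n * (2 * (\<Sum>j\<in>UNIV. norm (a j n)) + norm (a i n))"
          using l_bounds[of n] by (intro mult_left_mono) auto
        have "s i \<le> 1" using \<omega>[of i] by (simp add: s_def)
        have "norm (e n $ i) = s i * (l n * norm (2 *\<^sub>R mean (\<lambda>j. a j n) - a i n))"
          using s_pos[of i] l_bounds[of n] by (simp add: e_def)
        also have "\<dots> \<le> l n * norm (2 *\<^sub>R mean (\<lambda>j. a j n) - a i n)"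
          using \<open>s i \<le> 1\<close> s_pos[of i] l_bounds[of n] by (intro mult_left_le_one_le) auto
        also note *
        finally show "norm (e n $ i) \<le> 2 * (\<Sum>j\<in>UNIV. l n * norm (a j n)) + l n * norm (a i n)"
          by (simp add: distrib_left sum_distrib_left mult.left_commute)
      qed
      finally show "norm (norm (e n)) \<le> (\<Sum>i\<in>UNIV. 2 * (\<Sum>j\<in>UNIV. l n * norm (a j n)) + l n * norm (a i n))"
        by simp
    qed
    have \<mu>_sum: "filterlim (\<lambda>N. \<Sum>n<N. l n / 2 * (1 - l n / 2)) at_top sequentially"
    proof -
      have "(\<Sum>n<N. l n / 2 * (1 - l n / 2)) = (1 / 4) * (\<Sum>n<N. l n * (2 - l n))" for N
        by (simp add: sum_distrib_left field_simps)
      then show ?thesis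
        by (simp only:) (intro filterlim_tendsto_pos_mult_at_top[OF tendsto_const _ l_sum], simp)
    qed
    obtain W where W: "R W = W" "\<And>v. (\<lambda>n. Z n \<bullet> v) \<longlonglongrightarrow> W \<bullet> v"
      by (rule krasnoselskii_mann[OF R_nonexp fixQ _ step e_sum \<mu>_sum])
        (use l_bounds in \<open>auto simp: less_imp_le\<close>)
    have "(\<lambda>n. x n \<bullet> v) \<longlonglongrightarrow> mean (Y W) \<bullet> v" for v
    proof -
      \<comment> \<open>Testing against a weighted diagonal vector turns weak convergence in the product into that of the means.\<close>
      have inner: "V \<bullet> (\<chi> i. s i *\<^sub>R v) = mean (Y V) \<bullet> v" for V
        unfolding inner_vec_def mean_def inner_sum_left Z_coord[of V]
        by (simp add: s_mult mult.assoc[symmetric])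
      show ?thesis using W(2)[of "\<chi> i. s i *\<^sub>R v"] unfolding inner YZ' x_mean .
    qed
    then show ?thesis using fix_imp[OF W(1)] by (auto simp: converges_weakly_to_def)
  qed
  ultimately show ?thesis by blast
qed

end
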